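(* Let $n\ge 1$ and let $B_n$ be the Boolean algebra of subsets of $[n]=\{1,\dots,n\}$, $B_n^-=B_n\setminus\{\emptyset\}$, and $C_n$ the chain $0<1<\dots<n-1$. For each $j=0,\dots,n-1$, let $I_j(B_n)$ be the open principal lower order ideal $\{z\in B_n^-\ast C_n : z<([n],j)\}$ of the Rees product $B_n^-\ast C_n$. Then for all $j=0,1,\dots,n-1$, \[\dim \tilde H_{n-2}(I_j(B_n)) = a_{n,j},\] where $a_{n,j}$ is the Eulerian number, i.e. the number of permutations in $\mathfrak S_n$ with exactly $j$ descents (equivalently, with exactly $j$ excedances).
   Context: For ranked posets $P,Q$ with rank functions $r_P,r_Q$, the Rees product $P\ast Q$ is the set $\{(p,q)\in P\times Q: r_P(p)\ge r_Q(q)\}$ ordered by $(p_1,q_1)\le(p_2,q_2)$ iff $p_1\le_P p_2$, $q_1\le_Q q_2$, and $r_P(p_2)-r_P(p_1)\ge r_Q(q_2)-r_Q(q_1)$. (Ranks: the rank of $y$ in a ranked poset is the length of the longest chain ending at $y$; in $B_n^-$ the rank of a set $S$ is $|S|-1$, in $C_n$ the rank of $i$ is $i$.) The homology $\tilde H_k(P)$ of a poset $P$ means the reduced simplicial homology with complex coefficients of its order complex (the simplicial complex of chains of $P$); the empty poset has $\tilde H_{-1}\cong\mathbb C$. A descent of $\sigma\in\mathfrak S_n$ is $i\in[n-1]$ with $\sigma(i)>\sigma(i+1)$; an excedance is $i\in[n-1]$ with $\sigma(i)>i$. *)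

theory Defs
  imports "HOL-Algebra.AbelCoset" "HOL-Combinatorics.Permutations" "Jordan_Normal_Form.VS_Connect"
begin

text \<open>A poset is represented by its reflexive partial order \<open>r :: 'a rel\<close>, with ground set
  \<open>Field r\<close>. Induced subposets are restrictions \<open>Restr r A\<close>, and \<open>underS r z\<close> is the set of
  elements strictly below \<open>z\<close>.\<close>

subsection \<open>Rank and Rees product\<close>

text \<open>The length of a chain is one less than its number of elements.\<close>

definition poset_rank :: "'a rel \<Rightarrow> 'a \<Rightarrow> nat" where
  "poset_rank r y =
     Max {card c - 1 | c. c \<in> Chains r \<and> finite c \<and> y \<in> c \<and> (\<forall>x\<in>c. (x, y) \<in> r)}"

definition rees_carrier :: "'a rel \<Rightarrow> 'b rel \<Rightarrow> ('a \<times> 'b) set" where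
  "rees_carrier P Q =
     {(p, q). p \<in> Field P \<and> q \<in> Field Q \<and> poset_rank P p \<ge> poset_rank Q q}"

definition rees_product :: "'a rel \<Rightarrow> 'b rel \<Rightarrow> ('a \<times> 'b) rel" where
  "rees_product P Q =
     {((p1, q1), (p2, q2)). (p1, q1) \<in> rees_carrier P Q \<and> (p2, q2) \<in> rees_carrier P Q \<and>
        (p1, p2) \<in> P \<and> (q1, q2) \<in> Q \<and>
        int (poset_rank P p2) - int (poset_rank P p1)
          \<ge> int (poset_rank Q q2) - int (poset_rank Q q1)}"

definition open_lower_ideal :: "'a rel \<Rightarrow> 'a \<Rightarrow> 'a rel" where
  "open_lower_ideal r z = Restr r (underS r z)"

definition boolean_algebra :: "nat \<Rightarrow> nat set rel" where
  "boolean_algebra n = {(S, T). S \<subseteq> T \<and> T \<subseteq> {1..n}}"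

definition boolean_algebra_minus :: "nat \<Rightarrow> nat set rel" where
  "boolean_algebra_minus n =
     Restr (boolean_algebra n) (Field (boolean_algebra n) - {{}})"

definition chain_poset :: "nat \<Rightarrow> nat rel" where
  "chain_poset n = {(i, j). i \<le> j \<and> j < n}"

definition rees_ideal :: "nat \<Rightarrow> nat \<Rightarrow> (nat set \<times> nat) rel" where
  "rees_ideal n j =
     open_lower_ideal (rees_product (boolean_algebra_minus n) (chain_poset n)) ({1..n}, j)"

subsection \<open>Reduced simplicial homology of the order complex\<close>

text \<open>The empty chain is the unique simplex of dimension \<open>-1\<close>; this makes the homology reduced.\<close>

definition order_simplices :: "'a rel \<Rightarrow> int \<Rightarrow> 'a set set" where
  "order_simplices r k = {c \<in> Chains r. finite c \<and> int (card c) = k + 1}"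

text \<open>A \<open>k\<close>-chain \<open>f\<close> is the formal linear combination of simplices \<open>c\<close> with coefficients
  \<open>f c\<close>. The \<open>mult\<close> and \<open>one\<close> fields of module records are irrelevant.\<close>

definition chain_space :: "'a rel \<Rightarrow> int \<Rightarrow> (complex, 'a set \<Rightarrow> complex) module" where
  "chain_space r k =
     \<lparr>carrier = {f. finite {c. f c \<noteq> 0} \<and> {c. f c \<noteq> 0} \<subseteq> order_simplices r k},
      mult = undefined, one = undefined,
      zero = (\<lambda>c. 0), add = (\<lambda>f g c. f c + g c), smult = (\<lambda>a f c. a * f c)\<rparr>"

text \<open>Simplices are oriented by the order \<open>r\<close>: in \<open>x\<^sub>0 < \<dots> < x\<^sub>k\<close> the vertex \<open>x\<^sub>i\<close> has exactly
  \<open>i\<close> strict predecessors, so that deleting it carries the sign \<open>(-1)^i\<close>.\<close>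

definition boundary :: "'a rel \<Rightarrow> ('a set \<Rightarrow> complex) \<Rightarrow> ('a set \<Rightarrow> complex)" where
  "boundary r f =
     (\<lambda>t. \<Sum>c | f c \<noteq> 0. \<Sum>x | x \<in> c \<and> c - {x} = t. (-1) ^ card (underS r x \<inter> c) * f c)"

definition cycles :: "'a rel \<Rightarrow> int \<Rightarrow> ('a set \<Rightarrow> complex) set" where
  "cycles r k = {f \<in> carrier (chain_space r k). boundary r f = (\<lambda>t. 0)}"

definition boundaries :: "'a rel \<Rightarrow> int \<Rightarrow> ('a set \<Rightarrow> complex) set" where
  "boundaries r k = boundary r ` carrier (chain_space r (k + 1))"

definition quotient_module ::
  "('a, 'b, 'm) module_scheme \<Rightarrow> 'b set \<Rightarrow> ('a, 'b set) module" where
  "quotient_module M N =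
     \<lparr>carrier = a_rcosets\<^bsub>M\<^esub> N, mult = undefined, one = undefined,
      zero = N, add = set_add M,
      smult = (\<lambda>a X. \<Union>x\<in>X. N +>\<^bsub>M\<^esub> (a \<odot>\<^bsub>M\<^esub> x))\<rparr>"

definition reduced_homology :: "'a rel \<Rightarrow> int \<Rightarrow> (complex, ('a set \<Rightarrow> complex) set) module" where
  "reduced_homology r k =
     quotient_module (chain_space r k\<lparr>carrier := cycles r k\<rparr>) (boundaries r k)"

text \<open>As \<^const>\<open>vectorspace.dim\<close> is the least size of a finite generating set, this is only
  meaningful for finite-dimensional homology; finite posets always qualify.\<close>

abbreviation dim_reduced_homology :: "'a rel \<Rightarrow> int \<Rightarrow> nat" where
  "dim_reduced_homology r k \<equiv> vectorspace.dim class_ring (reduced_homology r k)"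

subsection \<open>Eulerian numbers\<close>

definition descents :: "nat \<Rightarrow> (nat \<Rightarrow> nat) \<Rightarrow> nat set" where
  "descents n \<sigma> = {i \<in> {1..n - 1}. \<sigma> i > \<sigma> (i + 1)}"

definition excedances :: "nat \<Rightarrow> (nat \<Rightarrow> nat) \<Rightarrow> nat set" where
  "excedances n \<sigma> = {i \<in> {1..n - 1}. \<sigma> i > i}"

definition eulerian :: "nat \<Rightarrow> nat \<Rightarrow> nat" where
  "eulerian n j = card {\<sigma>. \<sigma> permutes {1..n} \<and> card (descents n \<sigma>) = j}"

end

theory Submission
  imports Defs "HOL-Library.List_Lexorder" "HOL-Library.Product_Lexorder"
begin

text \<open>The top homology of the ideal is its space of top cycles. A maximal chain of the ideal is a
  permutation \<open>x\<^sub>1, \<dots>, x\<^sub>n\<close> of \<open>[n]\<close> (the order in which elements are added to the set) with labels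
  \<open>0 = a\<^sub>1, a\<^sub>2, \<dots>, a\<^sub>n \<in> {0, 1}\<close> of sum \<open>j\<close> (the increments of the second coordinate), and being a cycle
  is a local condition on the two entries adjacent to each rank. Call a chain falling if
  \<open>x\<^sub>k < x\<^sub>k\<^sub>+\<^sub>1\<close> forces \<open>(a\<^sub>k, a\<^sub>k\<^sub>+\<^sub>1) = (1, 0)\<close>. At a rank where this fails, the local condition expresses the
  coefficient through lexicographically larger chains, so a cycle is determined by its values on
  falling chains. Conversely every falling chain \<open>u\<close> carries an explicit cycle, supported on the
  chains that have the same sets as \<open>u\<close> at the ascents of \<open>u\<close> and the same second coordinates at
  the other ranks; these cycles are unitriangular on falling chains. So the dimension is the number
  of falling chains, and splitting at the smallest letter gives these the same generating function
  as permutations counted by descents.\<close>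

subsection \<open>Homology in the top degree\<close>

text \<open>Pairs of a letter and a label act as an edge labelling of EL type. Around a rank there
  are two fillings if the two labels agree or the rank is the lowest, and four otherwise; in each
  case exactly one ascends (weakly in the labels), and it is the lexicographically least. One local
  equation can eliminate only that filling, so falling chains must be defined by the componentwise
  order although the elimination runs along a linear one. The obstacle is the lower bound: a rank
  with four fillings leaves room for three independent cycles, not one. The way out is that a rank
  admits two exchanges, of letters and of labels, and a cycle only has to be antisymmetric under one
  of them. Letters are exchanged where the falling chain u descends. At an ascent of u the labels
  are 1, 0, so ascents are isolated and never at the lowest rank; there labels can be exchanged
  without disturbing the ranks next to it. As the letters of u decrease between ascents, u has the
  largest word of letters in its cycle, which is the source of triangularity.\<close>

lemma vectorspace_dim_eq_card:
  fixes W :: "('k :: field, 'w) module" and ev :: "'w \<Rightarrow> 'c \<Rightarrow> 'k"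
  assumes vs: "vectorspace class_ring W" and fin: "finite D"
    and add: "\<And>x y c. x \<in> carrier W \<Longrightarrow> y \<in> carrier W \<Longrightarrow> c \<in> D \<Longrightarrow> ev (x \<oplus>\<^bsub>W\<^esub> y) c = ev x c + ev y c"
    and smult: "\<And>a x c. x \<in> carrier W \<Longrightarrow> c \<in> D \<Longrightarrow> ev (a \<odot>\<^bsub>W\<^esub> x) c = a * ev x c"
    and inj: "\<And>x y. x \<in> carrier W \<Longrightarrow> y \<in> carrier W \<Longrightarrow> (\<And>c. c \<in> D \<Longrightarrow> ev x c = ev y c) \<Longrightarrow> x = y"
    and surj: "\<And>g. \<exists>x\<in>carrier W. \<forall>c\<in>D. ev x c = g c"
  shows "vectorspace.dim class_ring W = card D"
proof -
  define n where "n = card D"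
  obtain e where e: "bij_betw e {..<n} D"
    using fin unfolding n_def by (metis finite_same_card_bij finite_lessThan card_lessThan)
  define E where "E x = vec n (\<lambda>i. ev x (e i))" for x
  have eD: "e i \<in> D" if "i < n" for i using e that by (auto simp: bij_betw_def)
  have inj_E: "inj_on E (carrier W)"
  proof (rule inj_onI)
    fix x y assume xy: "x \<in> carrier W" "y \<in> carrier W" and eq: "E x = E y"
    show "x = y"
    proof (rule inj[OF xy])
      fix c assume "c \<in> D"
      then obtain i where "i < n" "c = e i" using e by (auto simp: bij_betw_def)
      then show "ev x c = ev y c" using eq by (auto simp: E_def vec_eq_iff)
    qed
  qed
  have surj_E: "E ` carrier W = carrier_vec n"
  proof
    show "carrier_vec n \<subseteq> E ` carrier W"
    proof
      fix v :: "'k vec" assume v: "v \<in> carrier_vec n"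
      obtain x where x: "x \<in> carrier W" "\<forall>c\<in>D. ev x c = v $ (inv_into {..<n} e c)"
        using surj[of "\<lambda>c. v $ (inv_into {..<n} e c)"] by blast
      have "E x = v"
        using v x(2) eD bij_betw_imp_inj_on[OF e] by (auto simp: E_def intro!: eq_vecI inv_into_f_f)
      then show "v \<in> E ` carrier W" using x(1) by blast
    qed
  qed (auto simp: E_def)
  \<comment> \<open>The inverse of \<open>E\<close> is used because the transport of dimensions
    along a linear bijection asks for a finite-dimensional source, and this is known for tuples but
    not yet for \<open>W\<close>.\<close>
  define T where "T = inv_into (carrier W) E"
  have bij_T: "bij_betw T (carrier_vec n) (carrier W)"
    unfolding T_def using inj_E surj_E by (intro bij_betw_inv_into) (simp add: bij_betw_def)
  have T_in: "T v \<in> carrier W" if "v \<in> carrier_vec n" for v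
    using bij_T that by (auto simp: bij_betw_def)
  have ET: "E (T v) = v" if "v \<in> carrier_vec n" for v
    unfolding T_def using that surj_E by (simp add: f_inv_into_f)
  have TE: "T (E x) = x" if "x \<in> carrier W" for x
    unfolding T_def using that inj_E by simp
  interpret W: vectorspace class_ring W by (fact vs)
  interpret V: vec_space "TYPE('k)" n .
  have E_add: "E (x \<oplus>\<^bsub>W\<^esub> y) = E x + E y" if "x \<in> carrier W" "y \<in> carrier W" for x y
    using that add eD by (auto simp: E_def)
  have E_smult: "E (a \<odot>\<^bsub>W\<^esub> x) = a \<cdot>\<^sub>v E x" if "x \<in> carrier W" for a x
    using that smult eD by (auto simp: E_def)
  have lin: "linear_map class_ring (module_vec TYPE('k) n) W T"
  proof -
    have "T (u + v) = T u \<oplus>\<^bsub>W\<^esub> T v" if "u \<in> carrier_vec n" "v \<in> carrier_vec n" for u v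
      using that T_in ET TE E_add by (metis W.M.a_closed)
    moreover have "T (a \<cdot>\<^sub>v v) = a \<odot>\<^bsub>W\<^esub> T v" if "v \<in> carrier_vec n" for a v
      using that T_in ET TE E_smult by (metis W.smult_closed UNIV_I partial_object.select_convs(1))
    ultimately show ?thesis
      using T_in
      by (intro linear_map.intro mod_hom.intro mod_hom_axioms.intro vs vec_vs vec_module W.module_axioms)
        (auto simp: LinearCombinations.module_hom_def module_vec_simps)
  qed
  have "vectorspace.dim class_ring (module_vec TYPE('k) n) = vectorspace.dim class_ring W"
    using bij_T
    by (intro linear_map.dim_eq[OF lin V.fin_dim]) (auto simp: bij_betw_def module_vec_simps)
  then show ?thesis using V.dim_is_n by (simp add: n_def)
qed

text \<open>The summation range in \<open>boundary\<close> is the support and so varies with the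
  chain; linearity can be read off once all terms are summed over one common finite set.\<close>

lemma boundary_eq_sum:
  assumes "finite A" "{c. f c \<noteq> 0} \<subseteq> A"
  shows "boundary r f t = (\<Sum>c\<in>A. \<Sum>x | x \<in> c \<and> c - {x} = t. (-1) ^ card (underS r x \<inter> c) * f c)"
  unfolding boundary_def using assms by (intro sum.mono_neutral_left) auto

lemma boundary_add:
  assumes "finite {c. f c \<noteq> 0}" "finite {c. g c \<noteq> 0}"
  shows "boundary r (\<lambda>c. f c + g c) t = boundary r f t + boundary r g t"
proof -
  let ?A = "{c. f c \<noteq> 0} \<union> {c. g c \<noteq> 0}"
  have "finite ?A" using assms by simp
  then show ?thesis
    by (subst (1 2 3) boundary_eq_sum[of ?A]) (auto simp: ring_distribs sum.distrib)
qed

lemma boundary_scale: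
  assumes "finite {c. f c \<noteq> 0}"
  shows "boundary r (\<lambda>c. a * f c) t = a * boundary r f t"
  using assms
  by (subst (1 2) boundary_eq_sum[of "{c. f c \<noteq> 0}"]) (auto simp: sum_distrib_left mult.left_commute)

lemma cycles_add:
  assumes "f \<in> cycles r k" "g \<in> cycles r k"
  shows "(\<lambda>c. f c + g c) \<in> cycles r k"
proof -
  have "{c. f c + g c \<noteq> 0} \<subseteq> {c. f c \<noteq> 0} \<union> {c. g c \<noteq> 0}" by auto
  then show ?thesis
    using assms by (auto simp: cycles_def chain_space_def boundary_add fun_eq_iff intro: finite_subset)
qed

lemma cycles_scale: "f \<in> cycles r k \<Longrightarrow> (\<lambda>c. a * f c) \<in> cycles r k"
  by (auto simp: cycles_def chain_space_def boundary_scale fun_eq_iff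
      intro: finite_subset[of _ "{c. f c \<noteq> 0}"])

lemma cycles_zero: "(\<lambda>c. 0) \<in> cycles r k"
  by (auto simp: cycles_def chain_space_def boundary_def)

text \<open>Without simplices of dimension \<open>k + 1\<close> the only boundary is 0, so each
  homology class is a singleton \<open>{f}\<close> and \<open>the_elem\<close> recovers the cycle.
  The values on \<open>D\<close> then serve as coordinates.\<close>

lemma dim_reduced_homology_top:
  fixes r :: "'a rel"
  assumes top: "order_simplices r (k + 1) = {}" and fin: "finite D"
    and inj: "\<And>f. f \<in> cycles r k \<Longrightarrow> (\<And>c. c \<in> D \<Longrightarrow> f c = 0) \<Longrightarrow> f = (\<lambda>c. 0)"
    and surj: "\<And>g. \<exists>f\<in>cycles r k. \<forall>c\<in>D. f c = g c"
  shows "dim_reduced_homology r k = card D"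
proof -
  let ?H = "reduced_homology r k"
  have bd: "boundaries r k = {\<lambda>c. 0}"
  proof -
    have "carrier (chain_space r (k + 1)) = {\<lambda>c. 0}"
      using top by (auto simp: chain_space_def)
    then show ?thesis by (simp add: boundaries_def boundary_def)
  qed
  have carr: "carrier ?H = (\<lambda>f. {f}) ` cycles r k"
    by (auto simp: reduced_homology_def quotient_module_def A_RCOSETS_def RCOSETS_def r_coset_def
        bd chain_space_def)
  have H_add: "{f} \<oplus>\<^bsub>?H\<^esub> {g} = {\<lambda>c. f c + g c}" for f g
    by (auto simp: reduced_homology_def quotient_module_def set_add_def set_mult_def chain_space_def)
  have H_zero: "\<zero>\<^bsub>?H\<^esub> = {\<lambda>c. 0}"
    by (simp add: reduced_homology_def quotient_module_def bd)
  have H_smult: "a \<odot>\<^bsub>?H\<^esub> {f} = {\<lambda>c. a * f c}" for a f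
    by (auto simp: reduced_homology_def quotient_module_def bd a_r_coset_def r_coset_def chain_space_def)
  have grp: "abelian_group ?H"
  proof (rule abelian_groupI)
    fix X assume "X \<in> carrier ?H"
    then obtain f where f: "f \<in> cycles r k" "X = {f}" by (auto simp: carr)
    have "{\<lambda>c. (-1) * f c} \<oplus>\<^bsub>?H\<^esub> X = \<zero>\<^bsub>?H\<^esub>" by (simp add: f H_add H_zero)
    then show "\<exists>Y\<in>carrier ?H. Y \<oplus>\<^bsub>?H\<^esub> X = \<zero>\<^bsub>?H\<^esub>"
      using cycles_scale[OF f(1), of "-1"] unfolding carr by blast
  qed (auto simp: carr H_add H_zero cycles_add cycles_zero add.commute add.left_commute)
  have mod: "module class_ring ?H"
  proof -
    interpret abelian_group ?H by (fact grp)
    show ?thesis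
      by unfold_locales (auto simp: carr H_add H_smult cycles_scale algebra_simps class_ring_simps)
  qed
  have vs: "vectorspace class_ring ?H"
    using mod class_field.field_axioms by (simp add: vectorspace_def)
  show ?thesis
  proof (rule vectorspace_dim_eq_card[OF vs fin, where ev = the_elem])
    fix X Y assume XY: "X \<in> carrier ?H" "Y \<in> carrier ?H"
      and eq: "\<And>c. c \<in> D \<Longrightarrow> the_elem X c = the_elem Y c"
    then obtain f g where fg: "f \<in> cycles r k" "g \<in> cycles r k" "X = {f}" "Y = {g}"
      by (auto simp: carr)
    have "(\<lambda>c. f c + (-1) * g c) = (\<lambda>c. 0)"
      using eq fg by (intro inj cycles_add cycles_scale) auto
    then show "X = Y" using fg by (simp add: fun_eq_iff)
  qed (use surj in \<open>auto simp: carr H_add H_smult\<close>)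
qed

subsection \<open>Descents and excedances\<close>

fun des :: "'a::linorder list \<Rightarrow> nat" where
  "des (x # y # zs) = (if y < x then 1 else 0) + des (y # zs)"
| "des _ = 0"

lemma des_append:
  "des (xs @ ys) = des xs + des ys + (if xs \<noteq> [] \<and> ys \<noteq> [] \<and> hd ys < last xs then 1 else 0)"
proof (induction xs rule: des.induct)
  case ("2_2" v)
  then show ?case by (cases ys) auto
qed auto

lemma des_eq_card: "des xs = card {i \<in> {1..<length xs}. xs ! i < xs ! (i - 1)}"
proof (induction xs rule: rev_induct)
  case (snoc x xs)
  show ?case
  proof (cases "xs = []")
    case False
    let ?D = "\<lambda>ys. {i \<in> {1..<length ys}. ys ! i < ys ! (i - 1)}"
    have "?D (xs @ [x]) = ?D xs \<union> (if x < last xs then {length xs} else {})"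
      using False by (auto simp: nth_append last_conv_nth less_Suc_eq)
    then show ?thesis using False by (simp add: des_append snoc card_insert_if)
  qed simp
qed simp

definition list_perms :: "'a set \<Rightarrow> 'a list set" where
  "list_perms X = {xs. distinct xs \<and> set xs = X}"

lemma finite_list_perms: "finite X \<Longrightarrow> finite (list_perms X)"
  by (rule finite_subset[OF _ finite_subset_distinct[of X]]) (auto simp: list_perms_def)

lemma length_list_perms: "xs \<in> list_perms X \<Longrightarrow> length xs = card X"
  by (auto simp: list_perms_def distinct_card)

text \<open>One-line notation. The inverse must fix everything outside \<open>{1..n}\<close>, as
  \<open>permutes\<close> demands, and it shifts by one because list positions start at 0.\<close>

lemma bij_betw_permutes_list_perms:
  "bij_betw (\<lambda>\<sigma>. map \<sigma> [1..<Suc n]) {\<sigma>. \<sigma> permutes {1..n}} (list_perms {1..n})"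
proof (rule bij_betw_byWitness[where f' = "\<lambda>xs i. if i \<in> {1..n} then xs ! (i - 1) else i"])
  show "(\<lambda>\<sigma>. map \<sigma> [1..<Suc n]) ` {\<sigma>. \<sigma> permutes {1..n}} \<subseteq> list_perms {1..n}"
  proof clarify
    fix \<sigma> :: "nat \<Rightarrow> nat" assume p: "\<sigma> permutes {1..n}"
    have "distinct (map \<sigma> [1..<Suc n])"
      using permutes_inj_on[OF p] by (simp add: distinct_map del: upt_Suc)
    moreover have "set (map \<sigma> [1..<Suc n]) = {1..n}"
      using permutes_image[OF p] by (simp add: atLeastLessThanSuc_atLeastAtMost del: upt_Suc)
    ultimately show "map \<sigma> [1..<Suc n] \<in> list_perms {1..n}"
      by (simp add: list_perms_def del: upt_Suc)
  qed
  show "(\<lambda>xs i. if i \<in> {1..n} then xs ! (i - 1) else i) ` list_perms {1..n} \<subseteq> {\<sigma>. \<sigma> permutes {1..n}}"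
  proof clarify
    fix xs assume xs: "xs \<in> list_perms {1..n}"
    have len: "length xs = n" using length_list_perms[OF xs] by simp
    let ?f = "\<lambda>i. if i \<in> {1..n} then xs ! (i - 1) else i"
    have "inj_on ?f {1..n}"
      using xs len by (auto simp: inj_on_def list_perms_def nth_eq_iff_index_eq)
    moreover have "?f ` {1..n} \<subseteq> {1..n}"
    proof clarify
      fix i assume "i \<in> {1..n}"
      then have "?f i = xs ! (i - 1)" "xs ! (i - 1) \<in> set xs" using len by auto
      then show "?f i \<in> {1..n}" using xs by (simp only: list_perms_def mem_Collect_eq)
    qed
    ultimately have "bij_betw ?f {1..n} {1..n}"
      unfolding bij_betw_def using endo_inj_surj[OF finite_atLeastAtMost] by blast
    then show "?f permutes {1..n}" by (rule bij_imp_permutes) auto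
  qed
qed (auto simp: fun_eq_iff permutes_def length_list_perms intro!: nth_equalityI simp del: upt_Suc)

lemma des_map_permutes: "des (map \<sigma> [1..<Suc n]) = card (descents n \<sigma>)"
proof -
  have "{i \<in> {1..<n}. \<sigma> (Suc i) < \<sigma> i} = descents n \<sigma>"
    by (auto simp: descents_def)
  moreover have "{i \<in> {1..<n}. map \<sigma> [1..<Suc n] ! i < map \<sigma> [1..<Suc n] ! (i - 1)} =
      {i \<in> {1..<n}. \<sigma> (Suc i) < \<sigma> i}"
    by (auto simp del: upt_Suc)
  ultimately show ?thesis unfolding des_eq_card by (simp del: upt_Suc)
qed

lemma eulerian_eq_card_list_perms:
  "eulerian n j = card {xs \<in> list_perms {1..n}. des xs = j}"
proof -
  have "bij_betw (\<lambda>\<sigma>. map \<sigma> [1..<Suc n]) {\<sigma> \<in> {\<sigma>. \<sigma> permutes {1..n}}. card (descents n \<sigma>) = j}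
     {xs \<in> list_perms {1..n}. des xs = j}"
    using bij_betw_permutes_list_perms[of n]
    by (rule bij_betw_Collect) (simp only: des_map_permutes)
  then show ?thesis by (auto simp: eulerian_def dest: bij_betw_same_card)
qed

text \<open>The common source of the Eulerian recurrence: of the \<open>Suc n\<close> extensions of
  an object x, exactly \<open>f x + 1\<close> keep the statistic and the other
  \<open>n - f x\<close> raise it by one. Stated abstractly, it serves both descents and excedances,
  which are then compared without a bijection between them.\<close>

lemma card_insertion_recurrence:
  fixes f :: "'a \<Rightarrow> nat" and f' :: "'c \<Rightarrow> nat"
  assumes fin: "finite S" "finite I" and I: "card I = Suc n"
    and bij: "bij_betw h (S \<times> I) S'"
    and stay: "\<And>x. x \<in> S \<Longrightarrow> card {i \<in> I. f' (h (x, i)) = f x} = Suc (f x)"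
    and step: "\<And>x i. x \<in> S \<Longrightarrow> i \<in> I \<Longrightarrow> f' (h (x, i)) = f x \<or> f' (h (x, i)) = Suc (f x)"
  shows "card {y \<in> S'. f' y = d} =
    Suc d * card {x \<in> S. f x = d} + (Suc n - d) * card {x \<in> S. Suc (f x) = d}"
proof -
  have "bij_betw h {p \<in> S \<times> I. f' (h p) = d} {y \<in> S'. f' y = d}"
    using bij by (rule bij_betw_Collect) simp
  then have "card {y \<in> S'. f' y = d} = card {p \<in> S \<times> I. f' (h p) = d}"
    by (simp add: bij_betw_same_card)
  also have "{p \<in> S \<times> I. f' (h p) = d} = (SIGMA x:S. {i \<in> I. f' (h (x, i)) = d})"
    by auto
  also have "card \<dots> = (\<Sum>x\<in>S. card {i \<in> I. f' (h (x, i)) = d})"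
    using fin by simp
  also have "\<dots> = (\<Sum>x\<in>S. Suc d * of_bool (f x = d) + (Suc n - d) * of_bool (Suc (f x) = d))"
  proof (rule sum.cong[OF refl])
    fix x assume x: "x \<in> S"
    have "{i \<in> I. f' (h (x, i)) = Suc (f x)} = I - {i \<in> I. f' (h (x, i)) = f x}"
      using step[OF x] by auto
    then have "card {i \<in> I. f' (h (x, i)) = Suc (f x)} = n - f x"
      using fin by (simp add: card_Diff_subset stay[OF x] I)
    moreover have "card {i \<in> I. f' (h (x, i)) = d} = 0" if "d \<noteq> f x" "d \<noteq> Suc (f x)"
    proof -
      have "{i \<in> I. f' (h (x, i)) = d} = {}" using step[OF x] that by auto
      then show ?thesis by (simp only: card.empty)
    qed
    ultimately show "card {i \<in> I. f' (h (x, i)) = d} =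
        Suc d * of_bool (f x = d) + (Suc n - d) * of_bool (Suc (f x) = d)"
      using stay[OF x] by (cases "d = f x"; cases "d = Suc (f x)") simp_all
  qed
  also have "\<dots> = Suc d * card {x \<in> S. f x = d} + (Suc n - d) * card {x \<in> S. Suc (f x) = d}"
    using fin by (simp add: sum.distrib flip: sum_distrib_left of_bool_def)
      (simp add: sum.If_cases Int_def of_bool_def)
  finally show ?thesis .
qed

lemma bij_betw_insert_max_list_perms:
  assumes "finite X" "m \<notin> X"
  shows "bij_betw (\<lambda>(xs, i). take i xs @ m # drop i xs) (list_perms X \<times> {..card X}) (list_perms (insert m X))"
proof (rule bij_betwI')
  fix p q assume p: "p \<in> list_perms X \<times> {..card X}" and q: "q \<in> list_perms X \<times> {..card X}"
  obtain xs i ys k where pq: "p = (xs, i)" "q = (ys, k)" by (metis surj_pair)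
  have *: "m \<notin> set xs" "m \<notin> set ys" "i \<le> length xs" "k \<le> length ys"
    using p q pq assms length_list_perms[of xs X] length_list_perms[of ys X]
    by (auto simp: list_perms_def)
  then have "take i xs @ m # drop i xs = take k ys @ m # drop k ys \<longleftrightarrow>
      take i xs = take k ys \<and> drop i xs = drop k ys"
    by (subst append_Cons_eq_iff) (auto dest: in_set_takeD in_set_dropD)
  also have "\<dots> \<longleftrightarrow> xs = ys \<and> i = k"
    using * by (metis append_take_drop_id length_take min.absorb2)
  finally show "((case p of (xs, i) \<Rightarrow> take i xs @ m # drop i xs) = (case q of (xs, i) \<Rightarrow> take i xs @ m # drop i xs)) = (p = q)"
    by (simp add: pq)
next
  fix p assume p: "p \<in> list_perms X \<times> {..card X}"
  then obtain xs i where pq: "p = (xs, i)" "xs \<in> list_perms X" by auto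
  have "take i xs @ drop i xs \<in> list_perms X" using pq by simp
  then show "(case p of (xs, i) \<Rightarrow> take i xs @ m # drop i xs) \<in> list_perms (insert m X)"
    using assms pq by (auto simp only: list_perms_def prod.case mem_Collect_eq set_append distinct_append
        set_simps distinct.simps)
next
  fix ys assume ys: "ys \<in> list_perms (insert m X)"
  then have "m \<in> set ys" by (simp add: list_perms_def)
  then obtain l r where lr: "ys = l @ m # r" by (metis split_list)
  have *: "l @ r \<in> list_perms X" using ys lr assms by (auto simp: list_perms_def)
  then have "length l \<le> card X" using length_list_perms[OF *] by simp
  then show "\<exists>p\<in>list_perms X \<times> {..card X}. ys = (case p of (xs, i) \<Rightarrow> take i xs @ m # drop i xs)"
    using * lr by (intro bexI[of _ "(l @ r, length l)"]) auto
qed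

text \<open>The largest letter makes no descent with its predecessor and always one with its
  successor. Inside the word it replaces the pair it breaks by one descent, so nothing is gained
  exactly when that pair was a descent; at the end there is no successor.\<close>

lemma des_insert_max:
  assumes "\<forall>x\<in>set xs. x < m" "i \<le> length xs"
  shows "des (take i xs @ m # drop i xs) =
    des xs + (if i = length xs \<or> i \<in> {1..<length xs} \<and> xs ! i < xs ! (i - 1) then 0 else 1)"
proof -
  have tl: "\<not> m < x" if "x \<in> set xs" for x using assms that by (auto dest: less_imp_not_less)
  have "des xs = des (take i xs) + des (drop i xs) +
      (if i \<noteq> 0 \<and> i < length xs \<and> xs ! i < xs ! (i - 1) then 1 else 0)"
  proof -
    have "last (take i xs) = xs ! (i - 1)" if "i \<noteq> 0"
      using assms(2) that by (cases "xs = []") (auto simp: last_conv_nth min_def)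
    then show ?thesis
      using des_append[of "take i xs" "drop i xs"] assms(2) by (auto simp: hd_drop_conv_nth)
  qed
  moreover have "des (take i xs @ m # drop i xs) =
      des (take i xs) + des (drop i xs) + (if i < length xs then 1 else 0)"
  proof -
    have "des (m # drop i xs) = des (drop i xs) + (if i < length xs then 1 else 0)"
    proof (cases "drop i xs")
      case (Cons a list)
      then have "a \<in> set xs" using in_set_dropD[of a i xs] by simp
      then show ?thesis using Cons assms by (cases "i < length xs") auto
    qed (use assms in auto)
    moreover have "\<not> m < last (take i xs)" if "take i xs \<noteq> []"
      using tl last_in_set[OF that] in_set_takeD by metis
    ultimately show ?thesis by (auto simp: des_append)
  qed
  ultimately show ?thesis using assms(2) by auto
qed

lemma card_des_Suc:
  "card {xs \<in> list_perms {1..Suc n}. des xs = d} =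
    Suc d * card {xs \<in> list_perms {1..n}. des xs = d} +
    (Suc n - d) * card {xs \<in> list_perms {1..n}. Suc (des xs) = d}"
proof (rule card_insertion_recurrence)
  show "bij_betw (\<lambda>(xs, i). take i xs @ Suc n # drop i xs) (list_perms {1..n} \<times> {..n}) (list_perms {1..Suc n})"
    using bij_betw_insert_max_list_perms[of "{1..n}" "Suc n"]
    by (simp add: atLeastAtMostSuc_conv)
next
  fix xs assume xs: "xs \<in> list_perms {1..n}"
  then have len: "length xs = n" and le: "\<forall>x\<in>set xs. x < Suc n"
    using length_list_perms[OF xs] by (auto simp: list_perms_def)
  have "{i \<in> {..n}. des (take i xs @ Suc n # drop i xs) = des xs} =
      insert n {i \<in> {1..<length xs}. xs ! i < xs ! (i - 1)}"
    using len le des_insert_max[of xs "Suc n" n]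
    by (auto simp: des_insert_max simp del: One_nat_def split: if_splits)
  then have "card {i \<in> {..n}. des (take i xs @ Suc n # drop i xs) = des xs} = Suc (des xs)"
    by (simp add: des_eq_card[of xs] len)
  then show "card {i \<in> {..n}. des (case (xs, i) of (xs, i) \<Rightarrow> take i xs @ Suc n # drop i xs) = des xs} = Suc (des xs)"
    by simp
  fix i assume "i \<in> {..n}"
  then show "des (case (xs, i) of (xs, i) \<Rightarrow> take i xs @ Suc n # drop i xs) = des xs \<or>
      des (case (xs, i) of (xs, i) \<Rightarrow> take i xs @ Suc n # drop i xs) = Suc (des xs)"
    using len le by (simp add: des_insert_max)
qed (auto simp: finite_list_perms)

text \<open>With \<open>b = \<sigma> k\<close>, the composition with the transposition inserts
  \<open>Suc n\<close> right after k in its cycle: k is sent to \<open>Suc n\<close> and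
  \<open>Suc n\<close> to \<open>\<sigma> k\<close>. This makes k an excedance and affects no other
  one, so the number is kept exactly if k already was one or \<open>k = Suc n\<close>, where the
  transposition is trivial.\<close>

lemma card_exc_Suc:
  "card {\<sigma> \<in> {\<sigma>. \<sigma> permutes {1..Suc n}}. card (excedances (Suc n) \<sigma>) = d} =
    Suc d * card {\<sigma> \<in> {\<sigma>. \<sigma> permutes {1..n}}. card (excedances n \<sigma>) = d} +
    (Suc n - d) * card {\<sigma> \<in> {\<sigma>. \<sigma> permutes {1..n}}. Suc (card (excedances n \<sigma>)) = d}"
proof (rule card_insertion_recurrence)
  let ?h = "\<lambda>(\<sigma>, b). transpose (Suc n) b \<circ> \<sigma> :: nat \<Rightarrow> nat"
  let ?P = "\<lambda>n. {\<sigma>. \<sigma> permutes {1..n}}"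
  have ins: "{1..Suc n} = insert (Suc n) {1..n}" by auto
  show "bij_betw ?h (?P n \<times> {1..Suc n}) (?P (Suc n))"
  proof (rule bij_betw_imageI)
    show "inj_on ?h (?P n \<times> {1..Suc n})"
    proof (rule inj_onI, clarify)
      fix \<sigma> \<tau> :: "nat \<Rightarrow> nat" and b c
      assume \<sigma>: "\<sigma> permutes {1..n}" and \<tau>: "\<tau> permutes {1..n}"
        and eq: "transpose (Suc n) b \<circ> \<sigma> = transpose (Suc n) c \<circ> \<tau>"
      have "\<sigma> (Suc n) = Suc n" "\<tau> (Suc n) = Suc n"
        using permutes_not_in[OF \<sigma>] permutes_not_in[OF \<tau>] by auto
      then have bc: "b = c" using fun_cong[OF eq, of "Suc n"] by simp
      have "\<sigma> = transpose (Suc n) b \<circ> (transpose (Suc n) b \<circ> \<sigma>)" by (simp add: fun_eq_iff)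
      also have "\<dots> = \<tau>" unfolding eq unfolding bc by (simp add: fun_eq_iff)
      finally show "\<sigma> = \<tau> \<and> b = c" using bc by simp
    qed
    show "?h ` (?P n \<times> {1..Suc n}) = ?P (Suc n)"
      unfolding ins permutes_insert by force
  qed
  have exc_eq: "excedances m \<sigma> = {i. i < \<sigma> i}" if "\<sigma> permutes {1..m}" for m \<sigma>
  proof -
    have "i < m \<and> 1 \<le> i" if "i < \<sigma> i" for i
      using permutes_in_image[OF \<open>\<sigma> permutes {1..m}\<close>, of i] permutes_not_in[OF \<open>\<sigma> permutes {1..m}\<close>, of i] that
      by (cases "i \<in> {1..m}") auto
    then show ?thesis by (force simp: excedances_def)
  qed
  fix \<sigma> assume "\<sigma> \<in> ?P n"
  then have \<sigma>: "\<sigma> permutes {1..n}" by simp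
  define E where "E = {i. i < \<sigma> i}"
  have fin: "finite E"
    using exc_eq[OF \<sigma>] by (metis E_def excedances_def finite_Collect_conjI finite_atLeastAtMost Collect_mem_eq)
  have fix_n: "\<sigma> (Suc n) = Suc n" using permutes_not_in[OF \<sigma>] by auto
  have E_le: "1 \<le> i \<and> i \<le> n" if "i \<in> E" for i
    using that permutes_in_image[OF \<sigma>, of i] permutes_not_in[OF \<sigma>, of i]
    by (cases "i \<in> {1..n}") (auto simp: E_def)
  have perm: "transpose (Suc n) b \<circ> \<sigma> permutes {1..Suc n}" if "b \<in> {1..Suc n}" for b
    using that permutes_subset[OF \<sigma>, of "{1..Suc n}"]
    by (intro permutes_compose permutes_swap_id) auto
  have E_ins: "{i. i < (transpose (Suc n) (\<sigma> k) \<circ> \<sigma>) i} = (if k = Suc n then E else insert k E)"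
    if "k \<in> {1..Suc n}" for k
  proof -
    have "i < (transpose (Suc n) (\<sigma> k) \<circ> \<sigma>) i \<longleftrightarrow> (if k = Suc n then i \<in> E else i = k \<or> i \<in> E)" for i
    proof (cases "i = k \<or> i = Suc n")
      case True
      have "\<sigma> k \<in> {1..Suc n}"
        using that permutes_in_image[OF permutes_subset[OF \<sigma>, of "{1..Suc n}"]] by auto
      then have "\<sigma> k \<le> Suc n" by simp
      then show ?thesis using True fix_n that by (auto simp: E_def)
    next
      case False
      then have "\<sigma> i \<noteq> \<sigma> k" "\<sigma> i \<noteq> Suc n"
        using permutes_inj[OF \<sigma>] fix_n by (metis injD)+
      then show ?thesis using False by (simp add: E_def)
    qed
    then show ?thesis by auto
  qed
  have surj: "\<exists>k\<in>{1..Suc n}. b = \<sigma> k" if "b \<in> {1..Suc n}" for b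
    using permutes_image[OF permutes_subset[OF \<sigma>, of "{1..Suc n}"]] that by auto
  have exc_h: "card (excedances (Suc n) (?h (\<sigma>, \<sigma> k))) = (if k = Suc n \<or> k \<in> E then card E else Suc (card E))"
    if "k \<in> {1..Suc n}" for k
  proof -
    have "\<sigma> k \<in> {1..Suc n}" using that permutes_in_image[OF permutes_subset[OF \<sigma>, of "{1..Suc n}"]] by auto
    from exc_eq[OF perm[OF this]] show ?thesis
      using E_ins[OF that] fin by (auto simp: insert_absorb)
  qed
  have E_sub: "E \<subseteq> {1..Suc n}" using E_le by force
  have "{b \<in> {1..Suc n}. card (excedances (Suc n) (?h (\<sigma>, b))) = card (excedances n \<sigma>)} =
      \<sigma> ` insert (Suc n) E"
  proof (rule Set.set_eqI)
    fix b
    show "b \<in> {b \<in> {1..Suc n}. card (excedances (Suc n) (?h (\<sigma>, b))) = card (excedances n \<sigma>)} \<longleftrightarrow>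
      b \<in> \<sigma> ` insert (Suc n) E"
    proof
      assume b: "b \<in> {b \<in> {1..Suc n}. card (excedances (Suc n) (?h (\<sigma>, b))) = card (excedances n \<sigma>)}"
      then obtain k where k: "k \<in> {1..Suc n}" "b = \<sigma> k" using surj by blast
      then show "b \<in> \<sigma> ` insert (Suc n) E"
        using b exc_h[OF k(1)] exc_eq[OF \<sigma>] by (auto simp: E_def split: if_splits)
    next
      assume "b \<in> \<sigma> ` insert (Suc n) E"
      then obtain k where k: "k \<in> insert (Suc n) E" "b = \<sigma> k" by blast
      then have k': "k \<in> {1..Suc n}" using E_sub by auto
      then have "\<sigma> k \<in> {1..Suc n}" using permutes_in_image[OF permutes_subset[OF \<sigma>, of "{1..Suc n}"]] by auto
      then show "b \<in> {b \<in> {1..Suc n}. card (excedances (Suc n) (?h (\<sigma>, b))) = card (excedances n \<sigma>)}"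
        using k exc_h[OF k'] exc_eq[OF \<sigma>] by (auto simp: E_def)
    qed
  qed
  moreover have "card (\<sigma> ` insert (Suc n) E) = Suc (card E)"
  proof -
    have "Suc n \<notin> E" using E_le by force
    then show ?thesis
      using fin card_image[OF inj_on_subset[OF permutes_inj[OF \<sigma>] subset_UNIV], of "insert (Suc n) E"] by simp
  qed
  ultimately show "card {b \<in> {1..Suc n}. card (excedances (Suc n) (?h (\<sigma>, b))) = card (excedances n \<sigma>)} =
      Suc (card (excedances n \<sigma>))"
    by (simp add: exc_eq[OF \<sigma>] E_def)
  fix b assume "b \<in> {1..Suc n}"
  then obtain k where k: "k \<in> {1..Suc n}" "b = \<sigma> k" using surj by blast
  then show "card (excedances (Suc n) (?h (\<sigma>, b))) = card (excedances n \<sigma>) \<or>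
      card (excedances (Suc n) (?h (\<sigma>, b))) = Suc (card (excedances n \<sigma>))"
    using exc_h[OF k(1)] exc_eq[OF \<sigma>] by (simp add: E_def)
qed (auto simp: finite_permutations)

text \<open>Both counts start from the empty permutation and obey the same recurrence. The induction
  treats all d at once because the recurrence for d also involves d - 1.\<close>

lemma eulerian_eq_card_excedances:
  "eulerian n j = card {\<sigma>. \<sigma> permutes {1..n} \<and> card (excedances n \<sigma>) = j}"
proof -
  have "\<forall>d. card {xs \<in> list_perms {1..n}. des xs = d} =
      card {\<sigma> \<in> {\<sigma>. \<sigma> permutes {1..n}}. card (excedances n \<sigma>) = d}"
  proof (induction n)
    case 0
    have "list_perms {1..0::nat} = {[]}" by (auto simp: list_perms_def)
    moreover have "{\<sigma>. \<sigma> permutes {1..0::nat}} = {id}" by auto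
    ultimately show ?case by (simp add: excedances_def Collect_conv_if conj_commute)
  next
    case (Suc n)
    have "card {xs \<in> list_perms {1..n}. Suc (des xs) = d} =
        card {\<sigma> \<in> {\<sigma>. \<sigma> permutes {1..n}}. Suc (card (excedances n \<sigma>)) = d}" for d
      using Suc by (cases d) simp_all
    then show ?case unfolding card_des_Suc card_exc_Suc using Suc by simp
  qed
  then show ?thesis by (simp add: eulerian_eq_card_list_perms)
qed

subsection \<open>Counting falling labelled permutations\<close>

text \<open>The first label is 0 because a one-element set has rank 0 and admits only the second
  coordinate 0; labels are at most 1 because the Rees order bounds the growth of the second
  coordinate by that of the rank. The alphabet \<open>X\<close> is arbitrary so that the pieces of a
  cut word are of the same kind.\<close>

definition labelled :: "'a set \<Rightarrow> ('a \<times> nat) list set" where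
  "labelled X = {u. distinct (map fst u) \<and> fst ` set u = X \<and> (\<forall>p\<in>set u. snd p \<le> 1) \<and>
     (u \<noteq> [] \<longrightarrow> snd (hd u) = 0)}"

definition label_sum :: "('a \<times> nat) list \<Rightarrow> nat" where
  "label_sum u = sum_list (map snd u)"

text \<open>These are the pairs that do not ascend in the product order on letters and labels, compared
  componentwise. A linear order would not do: it leaves two ascending fillings of a missing rank.\<close>

definition falling_pair :: "'a::linorder \<times> nat \<Rightarrow> 'a \<times> nat \<Rightarrow> bool" where
  "falling_pair p q \<longleftrightarrow> (fst p < fst q \<longrightarrow> snd p = 1 \<and> snd q = 0)"

definition falling :: "'a::linorder set \<Rightarrow> ('a \<times> nat) list set" where
  "falling X = {u \<in> labelled X. successively falling_pair u}"

lemma label_sum_simps [simp]: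
  "label_sum [] = 0" "label_sum (p # u) = snd p + label_sum u" "label_sum (u @ v) = label_sum u + label_sum v"
  by (simp_all add: label_sum_def)

lemma length_labelled: "u \<in> labelled X \<Longrightarrow> length u = card X"
  using distinct_card[of "map fst u"] by (simp add: labelled_def)

lemma finite_labelled: "finite X \<Longrightarrow> finite (labelled X)"
proof -
  assume X: "finite X"
  have "labelled X \<subseteq> {u. set u \<subseteq> X \<times> {..1} \<and> length u \<le> card X}"
  proof clarify
    fix u :: "('a \<times> nat) list" assume u: "u \<in> labelled X"
    have "p \<in> X \<times> {..1}" if "p \<in> set u" for p
    proof -
      have "fst p \<in> X" "snd p \<le> 1" using u that unfolding labelled_def by blast+
      then show ?thesis by (cases p) simp
    qed
    then show "set u \<subseteq> X \<times> {..1} \<and> length u \<le> card X"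
      using length_labelled[OF u] by (intro conjI subsetI) simp_all
  qed
  moreover have "finite {u. set u \<subseteq> X \<times> {..1::nat} \<and> length u \<le> card X}"
    using X by (intro finite_lists_length_le) auto
  ultimately show ?thesis by (rule finite_subset)
qed

lemma finite_falling: "finite X \<Longrightarrow> finite (falling X)"
  by (rule finite_subset[OF _ finite_labelled]) (auto simp: falling_def)

text \<open>The word descends into its smallest letter, which leaves the labels there free, and
  ascends out of it, which forces label 1 on the minimum and 0 on the next letter. That 0 is
  precisely the starting condition of \<open>labelled\<close>, so the right part is falling in its
  own right.\<close>

lemma falling_split_min:
  assumes l: "\<forall>p\<in>set l. m < fst p" and r: "\<forall>p\<in>set r. m < fst p"
  shows "l @ (m, \<alpha>) # r \<in> falling X \<longleftrightarrow>
    l \<in> falling (fst ` set l) \<and> r \<in> falling (fst ` set r) \<and> fst ` set l \<inter> fst ` set r = {} \<and>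
    X = insert m (fst ` set l \<union> fst ` set r) \<and> \<alpha> \<le> 1 \<and> (l = [] \<longrightarrow> \<alpha> = 0) \<and> (r \<noteq> [] \<longrightarrow> \<alpha> = 1)"
proof -
  have m: "m \<notin> fst ` set l" "m \<notin> fst ` set r" using l r by auto
  have "falling_pair (last l) (m, \<alpha>)" if "l \<noteq> []"
    using l last_in_set[OF that] by (force simp: falling_pair_def)
  moreover have "falling_pair (m, \<alpha>) (hd r) \<longleftrightarrow> \<alpha> = 1 \<and> snd (hd r) = 0" if "r \<noteq> []"
    using r hd_in_set[OF that] by (auto simp: falling_pair_def)
  ultimately have succ: "successively falling_pair (l @ (m, \<alpha>) # r) \<longleftrightarrow>
      successively falling_pair l \<and> successively falling_pair r \<and> (r \<noteq> [] \<longrightarrow> \<alpha> = 1 \<and> snd (hd r) = 0)"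
    by (auto simp: successively_append_iff successively_Cons)
  have mem: "u \<in> falling (fst ` set u) \<longleftrightarrow> distinct (map fst u) \<and> (\<forall>p\<in>set u. snd p \<le> 1) \<and>
      (u \<noteq> [] \<longrightarrow> snd (hd u) = 0) \<and> successively falling_pair u" for u :: "('a \<times> nat) list"
    by (simp add: falling_def labelled_def conj_assoc)
  have dist: "distinct (map fst (l @ (m, \<alpha>) # r)) \<longleftrightarrow>
      distinct (map fst l) \<and> distinct (map fst r) \<and> fst ` set l \<inter> fst ` set r = {}"
    using m by simp
  have letters: "fst ` set (l @ (m, \<alpha>) # r) = X \<longleftrightarrow> X = insert m (fst ` set l \<union> fst ` set r)"
    by (simp add: image_Un eq_commute[of X])
  have labels: "(\<forall>p\<in>set (l @ (m, \<alpha>) # r). snd p \<le> 1) \<longleftrightarrow>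
      (\<forall>p\<in>set l. snd p \<le> 1) \<and> \<alpha> \<le> 1 \<and> (\<forall>p\<in>set r. snd p \<le> 1)"
    by auto
  have first: "snd (hd (l @ (m, \<alpha>) # r)) = 0 \<longleftrightarrow> (l = [] \<longrightarrow> \<alpha> = 0) \<and> (l \<noteq> [] \<longrightarrow> snd (hd l) = 0)"
    by (cases l) simp_all
  have "l @ (m, \<alpha>) # r \<in> falling X \<longleftrightarrow> distinct (map fst (l @ (m, \<alpha>) # r)) \<and>
      fst ` set (l @ (m, \<alpha>) # r) = X \<and> (\<forall>p\<in>set (l @ (m, \<alpha>) # r). snd p \<le> 1) \<and>
      snd (hd (l @ (m, \<alpha>) # r)) = 0 \<and> successively falling_pair (l @ (m, \<alpha>) # r)"
    unfolding falling_def labelled_def by blast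
  then show ?thesis
    unfolding mem dist letters labels first succ by argo
qed

section \<open>Generating functions and their recursions at the smallest letter\<close>

abbreviation des_poly :: "'a::linorder set \<Rightarrow> nat poly" where
  "des_poly X \<equiv> \<Sum>xs\<in>list_perms X. monom 1 (des xs)"

abbreviation falling_poly :: "'a::linorder set \<Rightarrow> nat poly" where
  "falling_poly X \<equiv> \<Sum>u\<in>falling X. monom 1 (label_sum u)"

text \<open>The word is cut at its smallest letter m, with \<open>L\<close> the set of letters to
  the left. Leaving m is an ascent and entering it a descent, so the cut contributes one descent
  unless m comes first.\<close>

lemma des_poly_rec:
  assumes fin: "finite X" and m: "\<forall>x\<in>X. m < x"
  shows "des_poly (insert m X) =
    (\<Sum>L\<in>Pow X. (if L = {} then 1 else monom 1 1) * (des_poly L * des_poly (X - L)))"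
proof -
  let ?S = "SIGMA L:Pow X. list_perms L \<times> list_perms (X - L)"
  let ?h = "\<lambda>(L, l, r). l @ m # r"
  have mX: "m \<notin> X" using m by auto
  have bij: "bij_betw ?h ?S (list_perms (insert m X))"
  proof (rule bij_betw_imageI)
    have "l @ m # r = l' @ m # r' \<longleftrightarrow> l = l' \<and> r = r'"
      if "L \<subseteq> X" "l \<in> list_perms L" "r \<in> list_perms (X - L)"
        "L' \<subseteq> X" "l' \<in> list_perms L'" "r' \<in> list_perms (X - L')" for L l r L' l' r'
      using that mX by (subst append_Cons_eq_iff) (auto simp: list_perms_def)
    then show "inj_on ?h ?S"
      by (intro inj_onI) (auto simp: list_perms_def)
    show "?h ` ?S = list_perms (insert m X)"
    proof (intro equalityI subsetI)
      fix xs assume xs: "xs \<in> list_perms (insert m X)"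
      then have "m \<in> set xs" by (simp add: list_perms_def)
      then obtain l r where lr: "xs = l @ m # r" by (metis split_list)
      then have "(set l, l, r) \<in> ?S" using xs m by (auto simp: list_perms_def)
      then show "xs \<in> ?h ` ?S" using lr by (intro image_eqI[of _ _ "(set l, l, r)"]) simp_all
    next
      fix xs assume "xs \<in> ?h ` ?S"
      then obtain l r where *: "distinct l" "distinct r" "set l \<subseteq> X" "set r = X - set l" "xs = l @ m # r"
        by (auto simp: list_perms_def)
      then have "set l \<inter> set r = {}" "m \<notin> set l" "m \<notin> set r" "set l \<union> set r = X"
        using mX by blast+
      then show "xs \<in> list_perms (insert m X)" using * by (simp add: list_perms_def)
    qed
  qed
  have des: "des (l @ m # r) = des l + des r + (if L = {} then 0 else 1)"
    if "L \<subseteq> X" "l \<in> list_perms L" "r \<in> list_perms (X - L)" for L l r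
  proof -
    have "des (m # r) = des r"
      using that m by (cases r) (auto simp: list_perms_def dest: less_imp_not_less)
    moreover have "m < last l" if "l \<noteq> []"
      using last_in_set[OF that] \<open>L \<subseteq> X\<close> \<open>l \<in> list_perms L\<close> m by (auto simp: list_perms_def)
    ultimately show ?thesis using that by (auto simp: des_append list_perms_def)
  qed
  have "des_poly (insert m X) = (\<Sum>p\<in>?S. monom 1 (des (?h p)))"
    by (rule sum.reindex_bij_betw[OF bij, symmetric])
  also have "\<dots> = (\<Sum>L\<in>Pow X. \<Sum>(l, r)\<in>list_perms L \<times> list_perms (X - L). monom 1 (des (l @ m # r)))"
    using fin finite_subset[OF _ fin] by (subst sum.Sigma) (auto simp: finite_list_perms split_def)
  also have "\<dots> = (\<Sum>L\<in>Pow X. (if L = {} then 1 else monom 1 1) * (des_poly L * des_poly (X - L)))"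
  proof (rule sum.cong[OF refl])
    fix L assume L: "L \<in> Pow X"
    have "(\<Sum>(l, r)\<in>list_perms L \<times> list_perms (X - L). monom 1 (des (l @ m # r)) :: nat poly) =
      (\<Sum>(l, r)\<in>list_perms L \<times> list_perms (X - L).
        (if L = {} then 1 else monom 1 1) * (monom 1 (des l) * monom 1 (des r)))"
    proof (rule sum.cong[OF refl], clarify)
      fix l r assume "l \<in> list_perms L" "r \<in> list_perms (X - L)"
      then have "des (l @ m # r) = des l + des r + (if L = {} then 0 else 1)"
        using L by (intro des) auto
      then show "monom 1 (des (l @ m # r)) =
          (if L = {} then 1 else monom 1 1) * (monom 1 (des l) * monom 1 (des r) :: nat poly)"
        by (cases "L = {}") (simp_all add: mult_monom)
    qed
    also have "\<dots> = (if L = {} then 1 else monom 1 1) * (des_poly L * des_poly (X - L))"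
      unfolding sum_product sum.cartesian_product by (simp add: split_def sum_distrib_left)
    finally show "(\<Sum>(l, r)\<in>list_perms L \<times> list_perms (X - L). monom 1 (des (l @ m # r)) :: nat poly) =
      (if L = {} then 1 else monom 1 1) * (des_poly L * des_poly (X - L))" .
  qed
  finally show ?thesis .
qed

text \<open>The separator is recognised by its letter alone, as its label may differ on the two
  sides; hence the bound on the letters before it.\<close>

lemma append_labelled_eq_iff:
  assumes "\<forall>p\<in>set l. m < fst p" "\<forall>p\<in>set l'. m < fst p"
  shows "l @ (m, \<alpha>) # r = l' @ (m :: 'a :: linorder, \<beta> :: nat) # r' \<longleftrightarrow> l = l' \<and> \<alpha> = \<beta> \<and> r = r'"
  using assms
proof (induction l arbitrary: l')
  case Nil
  then show ?case by (cases l') auto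
next
  case (Cons p l)
  then show ?case by (cases l') auto
qed

text \<open>A minimum in last place may carry either label, whence the factor 1 + t, where t is
  \<open>monom 1 1\<close>; in the middle its label is 1. It cannot come first, because the first
  label is 0 and an ascent would follow. So the two labels in last place match the two extreme cuts
  of \<open>des_poly_rec\<close>, with the minimum first and last.\<close>

lemma falling_poly_rec:
  assumes fin: "finite X" and m: "\<forall>x\<in>X. m < x" and ne: "X \<noteq> {}"
  shows "falling_poly (insert m X) = (1 + monom 1 1) * falling_poly X +
    (\<Sum>L\<in>Pow X - {{}, X}. monom 1 1 * (falling_poly L * falling_poly (X - L)))"
proof -
  let ?S = "SIGMA L:Pow X - {{}, X}. falling L \<times> falling (X - L)"
  let ?h = "\<lambda>(L, l, r). l @ (m, 1) # r"
  let ?A = "\<lambda>\<alpha>. (\<lambda>l. l @ [(m, \<alpha>)]) ` falling X"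
  have mX: "m \<notin> X" using m by auto
  have letters: "fst ` set u = Y" if "u \<in> falling Y" for u :: "('a \<times> nat) list" and Y
    using that by (simp add: falling_def labelled_def)
  have gt: "\<forall>p\<in>set u. m < fst p" if "u \<in> falling Y" "Y \<subseteq> X" for u Y
    using letters[OF that(1)] that(2) m by force
  note inj = append_labelled_eq_iff
  have split: "falling (insert m X) = (?A 0 \<union> ?A 1) \<union> ?h ` ?S"
  proof (intro equalityI subsetI)
    fix u assume u: "u \<in> falling (insert m X)"
    then have "m \<in> fst ` set u" using letters by blast
    then obtain \<alpha> l r where lr: "u = l @ (m, \<alpha>) # r" by (metis imageE prod.collapse split_list)
    have dist: "distinct (map fst u)" and set: "fst ` set u = insert m X"
      using u by (auto simp: falling_def labelled_def)
    have "m \<notin> fst ` set l" "m \<notin> fst ` set r" using dist lr by auto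
    moreover have "fst ` set l \<subseteq> insert m X" "fst ` set r \<subseteq> insert m X" unfolding set[symmetric] lr by auto
    ultimately have sub: "fst ` set l \<subseteq> X" "fst ` set r \<subseteq> X" by blast+
    then have *: "\<forall>p\<in>set l. m < fst p" "\<forall>p\<in>set r. m < fst p" using m by auto
    define L where "L = fst ` set l"
    define R where "R = fst ` set r"
    have f: "l \<in> falling L" "r \<in> falling R" "L \<inter> R = {}" "insert m X = insert m (L \<union> R)"
      "\<alpha> \<le> 1" "l = [] \<Longrightarrow> \<alpha> = 0" "r \<noteq> [] \<Longrightarrow> \<alpha> = 1"
      using u unfolding lr falling_split_min[OF *] L_def R_def by auto
    have "m \<notin> L" "m \<notin> R" using * by (auto simp: L_def R_def)
    then have "m \<notin> L \<union> R" by simp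
    then have X: "X = L \<union> R" using f(4) mX by (metis insert_ident)
    have L: "L = {} \<longleftrightarrow> l = []" and R: "R = {} \<longleftrightarrow> r = []" by (simp_all add: L_def R_def)
    show "u \<in> (?A 0 \<union> ?A 1) \<union> ?h ` ?S"
    proof (cases "r = []")
      case True
      then have "l \<in> falling X" using f(1) X R by simp
      moreover have "\<alpha> = 0 \<or> \<alpha> = 1" using f(5) by auto
      ultimately show ?thesis unfolding lr True by blast
    next
      case False
      then have \<alpha>: "\<alpha> = 1" "l \<noteq> []" using f(6,7) by auto
      have "X - L = R" using X f(3) by blast
      moreover have "L \<in> Pow X - {{}, X}" using X f(3) L R False \<alpha>(2) by blast
      ultimately have "(L, l, r) \<in> ?S" using f(1,2) by simp
      then have "u \<in> ?h ` ?S" using lr \<alpha>(1) by (intro image_eqI[of _ _ "(L, l, r)"]) simp_all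
      then show ?thesis by simp
    qed
  next
    fix u assume "u \<in> (?A 0 \<union> ?A 1) \<union> ?h ` ?S"
    then consider "u \<in> ?A 0 \<union> ?A 1" | "u \<in> ?h ` ?S" by blast
    then show "u \<in> falling (insert m X)"
    proof cases
      case 1
      then obtain l \<alpha> where l: "l \<in> falling X" "\<alpha> \<le> 1" "u = l @ [(m, \<alpha>)]" by force
      have "l \<noteq> []" using letters[OF l(1)] ne by auto
      moreover have "[] \<in> falling (fst ` set ([] :: ('a \<times> nat) list))" by (simp add: falling_def labelled_def)
      ultimately show ?thesis
        unfolding l(3) using l(1,2) letters[OF l(1)] gt[OF l(1)] by (subst falling_split_min) simp_all
    next
      case 2
      then obtain p where p: "p \<in> ?S" "u = ?h p" by blast
      obtain L l r where "p = (L, l, r)" by (metis prod_cases3)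
      with p have L: "L \<subseteq> X" "L \<noteq> {}" "L \<noteq> X" and l: "l \<in> falling L" and r: "r \<in> falling (X - L)"
        and u: "u = l @ (m, 1) # r" by simp_all
      have "L \<inter> (X - L) = {}" "X = L \<union> (X - L)" using L by blast+
      moreover have "l \<noteq> []" using letters[OF l] L(2) by auto
      ultimately show ?thesis
        unfolding u using l r letters[OF l] letters[OF r] gt[OF l L(1)] gt[OF r Diff_subset]
        by (subst falling_split_min) simp_all
    qed
  qed
  have finS: "finite ?S" using fin finite_subset[OF _ fin] by (auto simp: finite_falling)
  have finA: "finite (?A \<alpha>)" for \<alpha> using fin by (simp add: finite_falling)
  have disj01: "?A 0 \<inter> ?A 1 = {}" by auto
  have ne_falling: "u \<noteq> []" if "u \<in> falling Y" "Y \<noteq> {}" for u :: "('a \<times> nat) list" and Y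
    using letters[OF that(1)] that(2) by auto
  have disj: "(?A 0 \<union> ?A 1) \<inter> ?h ` ?S = {}"
  proof -
    have "l' @ [(m, \<alpha>)] \<noteq> l @ (m, 1) # r"
      if "l' \<in> falling X" "L \<in> Pow X - {{}, X}" "l \<in> falling L" "r \<in> falling (X - L)" for l' \<alpha> L l r
    proof
      assume "l' @ [(m, \<alpha>)] = l @ (m, 1) # r"
      then have "r = []" using inj[of l' m l \<alpha> "[]" 1 r] gt[OF that(1)] gt[OF that(3)] that(2) by simp
      then show False using ne_falling[OF that(4)] that(2) by auto
    qed
    then have *: "?h p \<noteq> l' @ [(m, \<alpha>)]" if "p \<in> ?S" "l' \<in> falling X" for p l' \<alpha>
      using that by (cases p) (simp only: mem_Sigma_iff prod.case, metis)
    have "u \<notin> ?h ` ?S" if u: "u \<in> ?A 0 \<union> ?A 1" for u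
    proof
      assume "u \<in> ?h ` ?S"
      then obtain p where p: "p \<in> ?S" "u = ?h p" by blast
      obtain l' \<alpha> where l': "l' \<in> falling X" "u = l' @ [(m, \<alpha>)]" using u by blast
      show False using *[OF p(1) l'(1), of \<alpha>] p(2) l'(2) by simp
    qed
    then show ?thesis by blast
  qed
  have injS: "inj_on ?h ?S"
  proof (rule inj_onI)
    fix p q assume pq: "p \<in> ?S" "q \<in> ?S" "?h p = ?h q"
    obtain L l r L' l' r' where [simp]: "p = (L, l, r)" "q = (L', l', r')" by (metis prod_cases3)
    have *: "L \<subseteq> X" "l \<in> falling L" "r \<in> falling (X - L)" "L' \<subseteq> X" "l' \<in> falling L'" "r' \<in> falling (X - L')"
      using pq by simp_all
    have "l = l' \<and> r = r'"
      using inj[of l m l' 1 r 1 r'] pq(3) gt[OF *(2,1)] gt[OF *(5,4)] by simp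
    moreover have "L = L'" using letters[OF *(2)] letters[OF *(5)] calculation by simp
    ultimately show "p = q" by simp
  qed
  have sumA: "(\<Sum>u\<in>?A \<alpha>. monom 1 (label_sum u)) = monom 1 \<alpha> * falling_poly X" for \<alpha>
    by (subst sum.reindex) (auto simp: inj_on_def sum_distrib_left mult_monom add.commute)
  have "(\<Sum>u\<in>?h ` ?S. monom 1 (label_sum u) :: nat poly) = (\<Sum>p\<in>?S. monom 1 (label_sum (?h p)))"
    using injS by (subst sum.reindex) (auto simp: o_def)
  also have "\<dots> = (\<Sum>L\<in>Pow X - {{}, X}. \<Sum>(l, r)\<in>falling L \<times> falling (X - L). monom 1 (label_sum (l @ (m, 1) # r)))"
    using fin finite_subset[OF _ fin] by (subst sum.Sigma) (auto simp: finite_falling split_def)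
  also have "\<dots> = (\<Sum>L\<in>Pow X - {{}, X}. monom 1 1 * (falling_poly L * falling_poly (X - L)))"
    unfolding sum_product sum.cartesian_product by (simp add: split_def sum_distrib_left mult_monom)
  finally have "falling_poly (insert m X) = monom 1 0 * falling_poly X + monom 1 1 * falling_poly X +
      (\<Sum>L\<in>Pow X - {{}, X}. monom 1 1 * (falling_poly L * falling_poly (X - L)))"
    unfolding split using disj disj01 finS finA
    by (subst sum.union_disjoint) (simp_all add: sum.union_disjoint sumA del: One_nat_def)
  moreover have "monom (1 :: nat) 0 = 1" by (simp add: monom_0 one_pCons)
  ultimately show ?thesis by (simp only: distrib_right mult_1)
qed

lemma des_poly_eq_falling_poly:
  assumes "finite X"
  shows "des_poly X = falling_poly X"
  using assms
proof (induction X rule: finite_psubset_induct)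
  case (psubset X)
  have empty: "list_perms {} = {[]}" "falling {} = {[]}"
    by (auto simp: list_perms_def falling_def labelled_def)
  show ?case
  proof (cases "X = {}")
    case True
    then show ?thesis by (simp add: empty)
  next
    case False
    define m where "m = Min X"
    define Y where "Y = X - {m}"
    have m: "m \<in> X" "\<forall>x\<in>Y. m < x" and X: "X = insert m Y" and Y: "finite Y" "Y \<subset> X"
      using psubset.hyps False by (auto simp: m_def Y_def less_le intro: Min_in)
    have IH: "des_poly L = falling_poly L" if "L \<subseteq> Y" for L
      using psubset.IH that Y by blast
    \<comment> \<open>One-letter words are treated apart: their letter is also the first one, so its
      label is forced to be 0 and the factor 1 + t would be wrong.\<close>
    show ?thesis
    proof (cases "Y = {}")
      case True
      have "xs = [m]" if xs: "xs \<in> list_perms {m}" for xs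
      proof -
        obtain x where "xs = [x]" using length_list_perms[OF xs] by (cases xs) auto
        then show ?thesis using xs by (simp add: list_perms_def)
      qed
      moreover have "[m] \<in> list_perms {m}" by (simp add: list_perms_def)
      ultimately have "list_perms {m} = {[m]}" by blast
      moreover have "u = [(m, 0)]" if u: "u \<in> labelled {m}" for u
      proof -
        obtain x \<alpha> where "u = [(x, \<alpha>)]" using length_labelled[OF u] by (cases u) auto
        then show ?thesis using u by (simp add: labelled_def)
      qed
      moreover have "[(m, 0)] \<in> falling {m}" by (simp add: falling_def labelled_def)
      ultimately have "falling {m} = {[(m, 0)]}" unfolding falling_def by blast
      with \<open>list_perms {m} = {[m]}\<close> show ?thesis using True X by simp
    next
      case ne: False
      have one: "monom (Suc 0) 0 = (1 :: nat poly)" by (simp add: monom_0 one_pCons)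
      define F where "F L = (if L = {} then 1 else monom 1 1) * (des_poly L * des_poly (Y - L))" for L
      have "des_poly X = sum F (Pow Y)"
        unfolding X F_def by (rule des_poly_rec[OF Y(1) m(2)])
      also have "\<dots> = F {} + sum F (Pow Y - {{}})"
        using Y(1) by (intro sum.remove) simp_all
      also have "sum F (Pow Y - {{}}) = F Y + sum F (Pow Y - {{}} - {Y})"
        using Y(1) ne by (intro sum.remove) simp_all
      also have "Pow Y - {{}} - {Y} = Pow Y - {{}, Y}" by blast
      also have "sum F (Pow Y - {{}, Y}) = (\<Sum>L\<in>Pow Y - {{}, Y}. monom 1 1 * (des_poly L * des_poly (Y - L)))"
        by (intro sum.cong) (simp_all add: F_def)
      also have "F {} = des_poly Y" by (simp add: F_def empty one)
      also have "F Y = monom 1 1 * des_poly Y" using ne by (simp add: F_def empty one)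
      finally have "des_poly X = des_poly Y + (monom 1 1 * des_poly Y +
          (\<Sum>L\<in>Pow Y - {{}, Y}. monom 1 1 * (des_poly L * des_poly (Y - L))))" .
      also have "\<dots> = falling_poly X"
      proof -
        have "(\<Sum>L\<in>Pow Y - {{}, Y}. monom 1 1 * (des_poly L * des_poly (Y - L))) =
            (\<Sum>L\<in>Pow Y - {{}, Y}. monom 1 1 * (falling_poly L * falling_poly (Y - L)))"
        proof (rule sum.cong[OF refl])
          fix L assume "L \<in> Pow Y - {{}, Y}"
          then have "L \<subseteq> Y" "Y - L \<subseteq> Y" by blast+
          then show "monom 1 1 * (des_poly L * des_poly (Y - L)) = monom 1 1 * (falling_poly L * falling_poly (Y - L))"
            by (simp only: IH)
        qed
        then show ?thesis
          unfolding X falling_poly_rec[OF Y(1) m(2) ne] by (simp only: IH[OF subset_refl] distrib_right mult_1 add.assoc)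
      qed
      finally show ?thesis .
    qed
  qed
qed

lemma coeff_sum_monom:
  "finite S \<Longrightarrow> coeff (\<Sum>x\<in>S. monom (1 :: nat) (f x)) j = card {x \<in> S. f x = j}"
  by (simp add: coeff_sum sum.If_cases Int_def)

lemma card_falling: "card {u \<in> falling {1..n}. label_sum u = j} = eulerian n j"
  using des_poly_eq_falling_poly[of "{1..n}"] coeff_sum_monom[of "list_perms {1..n}" des j]
    coeff_sum_monom[of "falling {1..n}" label_sum j] finite_list_perms[of "{1..n}"] finite_falling[of "{1..n}"]
  by (simp only: eulerian_eq_card_list_perms finite_atLeastAtMost)

subsection \<open>Maximal chains of the ideal\<close>

lemma poset_rank_eqI:
  assumes "c \<in> Chains r" "finite c" "y \<in> c" "\<And>x. x \<in> c \<Longrightarrow> (x, y) \<in> r" "card c = Suc k"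
    and le: "\<And>c. c \<in> Chains r \<Longrightarrow> finite c \<Longrightarrow> y \<in> c \<Longrightarrow> (\<And>x. x \<in> c \<Longrightarrow> (x, y) \<in> r) \<Longrightarrow> card c \<le> Suc k"
  shows "poset_rank r y = k"
proof -
  let ?K = "{card c - 1 | c. c \<in> Chains r \<and> finite c \<and> y \<in> c \<and> (\<forall>x\<in>c. (x, y) \<in> r)}"
  have bound: "z \<le> k" if "z \<in> ?K" for z
    using that le by fastforce
  then have "?K \<subseteq> {..k}" by blast
  \<comment> \<open>\<open>Max\<close> is meaningful for finite sets only, so the bound on chains
    has to supply finiteness besides maximality.\<close>
  then have "finite ?K" by (rule finite_subset) simp
  moreover have "k \<in> ?K"
    using assms(1-5) by (intro CollectI exI[of _ c]) simp
  ultimately have "Max ?K = k" using bound by (intro Max_eqI)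
  then show ?thesis by (simp only: poset_rank_def)
qed

lemma boolean_algebra_minus_iff:
  "(S, T) \<in> boolean_algebra_minus n \<longleftrightarrow> S \<noteq> {} \<and> S \<subseteq> T \<and> T \<subseteq> {1..n}"
proof -
  have "Field (boolean_algebra n) = {S. S \<subseteq> {1..n}}"
    unfolding Field_def Domain_unfold Range_iff boolean_algebra_def by blast
  then show ?thesis unfolding boolean_algebra_minus_def boolean_algebra_def by blast
qed

lemma Field_boolean_algebra_minus: "Field (boolean_algebra_minus n) = {S. S \<noteq> {} \<and> S \<subseteq> {1..n}}"
proof (rule Set.set_eqI)
  fix S
  show "S \<in> Field (boolean_algebra_minus n) \<longleftrightarrow> S \<in> {S. S \<noteq> {} \<and> S \<subseteq> {1..n}}"
    unfolding Field_def Un_iff Domain_iff Range_iff boolean_algebra_minus_iff mem_Collect_eq by blast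
qed

lemma Field_chain_poset: "Field (chain_poset n) = {..<n}"
  by (auto simp: Field_def Domain_unfold Range_iff chain_poset_def)

lemma chain_poset_iff: "(i, j) \<in> chain_poset n \<longleftrightarrow> i \<le> j \<and> j < n"
  by (simp add: chain_poset_def)

text \<open>The nonempty initial segments of a listing of \<open>S\<close> form a longest chain. No
  chain is longer, since cardinality is injective on a chain of finite sets and takes values in
  \<open>{1..card S}\<close>.\<close>

lemma poset_rank_boolean_algebra_minus:
  assumes "S \<noteq> {}" "S \<subseteq> {1..n}"
  shows "poset_rank (boolean_algebra_minus n) S = card S - 1"
proof (rule poset_rank_eqI)
  have fin: "finite S" using assms(2) finite_subset by blast
  then have pos: "card S > 0" using assms(1) by (simp add: card_gt_0_iff)
  define xs where "xs = sorted_list_of_set S"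
  have xs: "distinct xs" "set xs = S" "length xs = card S"
    using fin by (simp_all add: xs_def)
  let ?f = "\<lambda>k. set (take k xs)"
  let ?c = "?f ` {1..card S}"
  have card_f: "card (?f k) = k" if "k \<le> card S" for k
    using xs that by (simp add: distinct_card)
  have mono: "?f k \<subseteq> ?f l" if "k \<le> l" for k l
    using that by (rule set_take_subset_set_take)
  have sub: "?f k \<subseteq> S" for k using xs(2) set_take_subset by metis
  have ne: "?f k \<noteq> {}" if "k \<in> {1..card S}" for k using card_f[of k] that by force
  have rel: "(?f k, ?f l) \<in> boolean_algebra_minus n" if "k \<in> {1..card S}" "k \<le> l" for k l
    unfolding boolean_algebra_minus_iff using ne[OF that(1)] mono[OF that(2)] sub[of l] assms(2) by blast
  have S: "S = ?f (card S)" using xs by simp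
  show "?c \<in> Chains (boolean_algebra_minus n)"
    unfolding Chains_def
  proof (intro CollectI ballI)
    fix A B assume "A \<in> ?c" "B \<in> ?c"
    then obtain k l where "k \<in> {1..card S}" "l \<in> {1..card S}" "A = ?f k" "B = ?f l" by blast
    then show "(A, B) \<in> boolean_algebra_minus n \<or> (B, A) \<in> boolean_algebra_minus n"
      using nat_le_linear[of k l] by (elim disjE) (simp_all add: rel)
  qed
  show "S \<in> ?c" using S pos by (intro image_eqI[of _ _ "card S"]) auto
  show "(T, S) \<in> boolean_algebra_minus n" if "T \<in> ?c" for T
  proof -
    obtain k where "k \<in> {1..card S}" "T = ?f k" using \<open>T \<in> ?c\<close> by blast
    then show ?thesis using rel[of k "card S"] S by simp
  qed
  have "inj_on ?f {1..card S}"
    by (rule inj_onI) (metis card_f atLeastAtMost_iff)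
  then show "card ?c = Suc (card S - 1)" using pos by (simp add: card_image)
  fix c assume c: "c \<in> Chains (boolean_algebra_minus n)" and le: "\<And>T. T \<in> c \<Longrightarrow> (T, S) \<in> boolean_algebra_minus n"
  have "inj_on card c"
  proof (rule inj_onI)
    fix A B assume AB: "A \<in> c" "B \<in> c" "card A = card B"
    have "finite A" "finite B" using le[OF AB(1)] le[OF AB(2)] fin finite_subset
      unfolding boolean_algebra_minus_iff by blast+
    moreover have "A \<subseteq> B \<or> B \<subseteq> A"
      using c AB by (auto simp: Chains_def boolean_algebra_minus_iff)
    ultimately show "A = B" using AB(3) card_subset_eq by metis
  qed
  moreover have "card ` c \<subseteq> {1..card S}"
  proof
    fix k assume "k \<in> card ` c"
    then obtain T where T: "T \<in> c" "k = card T" by blast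
    then have "T \<noteq> {}" "T \<subseteq> S" using le[of T] unfolding boolean_algebra_minus_iff by blast+
    then show "k \<in> {1..card S}"
      using T fin card_mono[of S T] finite_subset[of T S] card_gt_0_iff[of T] by auto
  qed
  ultimately have "card c \<le> card S"
    by (metis card_image card_mono card_atLeastAtMost diff_Suc_1 finite_atLeastAtMost)
  then show "card c \<le> Suc (card S - 1)" using pos by simp
qed simp

lemma poset_rank_chain_poset:
  assumes "i < n"
  shows "poset_rank (chain_poset n) i = i"
proof (rule poset_rank_eqI[where c = "{..i}"])
  fix c assume "\<And>x. x \<in> c \<Longrightarrow> (x, i) \<in> chain_poset n"
  then have "c \<subseteq> {..i}" by (auto simp: chain_poset_def)
  then show "card c \<le> Suc i" using card_mono[of "{..i}" c] by simp
qed (use assms in \<open>auto simp: Chains_def chain_poset_def\<close>)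

text \<open>Differences of ranks are differences of cardinalities here; the terms are moved across
  the inequality to avoid truncated subtraction.\<close>

definition rees_le :: "'a set \<times> nat \<Rightarrow> 'a set \<times> nat \<Rightarrow> bool" where
  "rees_le p q \<longleftrightarrow> fst p \<subseteq> fst q \<and> snd p \<le> snd q \<and> snd q + card (fst p) \<le> snd p + card (fst q)"

definition in_rees_ideal :: "nat \<Rightarrow> nat \<Rightarrow> nat set \<times> nat \<Rightarrow> bool" where
  "in_rees_ideal n j p \<longleftrightarrow> fst p \<noteq> {} \<and> fst p \<subset> {1..n} \<and> snd p < card (fst p) \<and> rees_le p ({1..n}, j)"

lemma rees_carrier_iff:
  "(S, a) \<in> rees_carrier (boolean_algebra_minus n) (chain_poset n) \<longleftrightarrow>
    S \<noteq> {} \<and> S \<subseteq> {1..n} \<and> a < card S"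
proof -
  have "a < card S \<longleftrightarrow> a < n \<and> a \<le> card S - 1" if "S \<noteq> {}" "S \<subseteq> {1..n}"
  proof -
    have "finite S" using that finite_subset by blast
    then have "card S > 0" "card S \<le> n" using that card_mono[of "{1..n}" S] by (auto simp: card_gt_0_iff)
    then show ?thesis by linarith
  qed
  then show ?thesis
    using poset_rank_boolean_algebra_minus[of S n] poset_rank_chain_poset[of a n]
    unfolding rees_carrier_def Field_boolean_algebra_minus Field_chain_poset
    by (cases "S = {}"; cases "S \<subseteq> {1..n}"; cases "a < n") simp_all
qed

lemma rees_product_iff:
  "(p, q) \<in> rees_product (boolean_algebra_minus n) (chain_poset n) \<longleftrightarrow>
    fst p \<noteq> {} \<and> snd p < card (fst p) \<and> fst q \<subseteq> {1..n} \<and> snd q < card (fst q) \<and> rees_le p q"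
proof -
  obtain S a T b where pq: "p = (S, a)" "q = (T, b)" by (metis surj_pair)
  show ?thesis
  proof (cases "S \<noteq> {} \<and> S \<subseteq> T \<and> T \<subseteq> {1..n} \<and> a < card S \<and> b < card T")
    case True
    then have ST: "S \<noteq> {}" "S \<subseteq> {1..n}" "T \<noteq> {}" "T \<subseteq> {1..n}" by auto
    have "card S \<le> n" "card T \<le> n" using ST card_mono[of "{1..n}"] by fastforce+
    then have "a < n" "b < n" using True by linarith+
    then have "(p, q) \<in> rees_product (boolean_algebra_minus n) (chain_poset n) \<longleftrightarrow>
        a \<le> b \<and> int b - int a \<le> int (card T - 1) - int (card S - 1)"
      using True ST poset_rank_chain_poset[of a n] poset_rank_chain_poset[of b n]
        poset_rank_boolean_algebra_minus[of S n] poset_rank_boolean_algebra_minus[of T n]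
      unfolding pq rees_product_def mem_Collect_eq prod.case rees_carrier_iff boolean_algebra_minus_iff
      by (simp add: chain_poset_iff)
    then show ?thesis
      using True unfolding pq rees_le_def by auto
  next
    case False
    have "(p, q) \<notin> rees_product (boolean_algebra_minus n) (chain_poset n)"
      using False unfolding pq rees_product_def rees_carrier_iff boolean_algebra_minus_iff by auto
    moreover have "\<not> (fst p \<noteq> {} \<and> snd p < card (fst p) \<and> fst q \<subseteq> {1..n} \<and> snd q < card (fst q) \<and> rees_le p q)"
      using False unfolding pq rees_le_def by auto
    ultimately show ?thesis by blast
  qed
qed

lemma rees_ideal_iff:
  assumes "j < n"
  shows "(p, q) \<in> rees_ideal n j \<longleftrightarrow> in_rees_ideal n j p \<and> in_rees_ideal n j q \<and> rees_le p q"
proof -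
  have *: "p \<in> underS (rees_product (boolean_algebra_minus n) (chain_poset n)) ({1..n}, j) \<longleftrightarrow>
      in_rees_ideal n j p" for p
  proof -
    \<comment> \<open>If the set is full, the rank inequality forces the second coordinate to be j
      as well. Hence being strictly below the top amounts to having a proper subset.\<close>
    have "p = ({1..n}, j)" if "rees_le p ({1..n}, j)" "fst p = {1..n}"
      using that by (cases p) (simp add: rees_le_def)
    then show ?thesis
      using assms by (auto simp: underS_def rees_product_iff in_rees_ideal_def rees_le_def psubset_eq)
  qed
  show ?thesis
    unfolding rees_ideal_def open_lower_ideal_def
    using rees_product_iff * by (auto simp: in_rees_ideal_def)
qed

section \<open>Maximal chains as labelled permutations\<close>

definition node :: "('a \<times> nat) list \<Rightarrow> nat \<Rightarrow> 'a set \<times> nat" where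
  "node u k = (fst ` set (take k u), label_sum (take k u))"

definition maxchain :: "nat \<Rightarrow> ('a \<times> nat) list \<Rightarrow> ('a set \<times> nat) set" where
  "maxchain n u = node u ` {1..<n}"

definition labelled_perms :: "nat \<Rightarrow> nat \<Rightarrow> (nat \<times> nat) list set" where
  "labelled_perms n j = {u \<in> labelled {1..n}. label_sum u = j}"

lemma label_sum_le_length: "\<forall>p\<in>set u. snd p \<le> 1 \<Longrightarrow> label_sum u \<le> length u"
  by (induction u) auto

lemma card_fst_node:
  assumes "u \<in> labelled X" "k \<le> card X"
  shows "card (fst (node u k)) = k"
proof -
  have "distinct (map fst (take k u))"
    using assms(1) by (simp add: labelled_def distinct_take flip: take_map)
  then have "card (set (map fst (take k u))) = length (map fst (take k u))" by (rule distinct_card)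
  then show ?thesis using assms length_labelled[OF assms(1)] by (simp add: node_def)
qed

text \<open>Index 0 is a virtual bottom and index n gives the top \<open>({1..n}, j)\<close>.
  Neither lies in the ideal, but with them every rank of a maximal chain has a node on both
  sides.\<close>

lemma node_0 [simp]: "node u 0 = ({}, 0)"
  by (simp add: node_def)

lemma node_full: "u \<in> labelled X \<Longrightarrow> node u (card X) = (X, label_sum u)"
  using length_labelled[of u X] by (simp add: node_def labelled_def)

lemma node_labelled_perms_full: "u \<in> labelled_perms n j \<Longrightarrow> node u n = ({1..n}, j)"
  using node_full[of u "{1..n}"] by (simp add: labelled_perms_def)

lemma rees_le_node:
  assumes u: "u \<in> labelled X" and kl: "k \<le> l" "l \<le> card X"
  shows "rees_le (node u k) (node u l)"
proof -
  define w where "w = take (l - k) (drop k u)"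
  have take: "take l u = take k u @ w"
    using kl by (metis w_def take_add le_add_diff_inverse)
  have "\<forall>p\<in>set w. snd p \<le> 1"
    using u by (auto simp: w_def labelled_def dest!: in_set_takeD in_set_dropD)
  then have "label_sum w \<le> l - k"
    using label_sum_le_length[of w] by (simp add: w_def)
  moreover have "card (fst (node u k)) = k" "card (fst (node u l)) = l"
    using card_fst_node[OF u] kl by simp_all
  moreover have "fst (node u k) \<subseteq> fst (node u l)" "snd (node u l) = snd (node u k) + label_sum w"
    unfolding node_def take by auto
  ultimately show ?thesis using kl by (simp add: rees_le_def)
qed

text \<open>The first step adds label 0, which gives strictness; each later step adds at most
  1.\<close>

lemma snd_node_less:
  assumes u: "u \<in> labelled X" and k: "1 \<le> k" "k \<le> card X"
  shows "snd (node u k) < k"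
proof -
  have "u \<noteq> []" using length_labelled[OF u] k by auto
  then obtain p w where pw: "u = p # w" by (cases u) auto
  then have "snd (node u 1) = 0" using u by (simp add: node_def labelled_def)
  then show ?thesis
    using rees_le_node[OF u k(1,2)] card_fst_node[OF u, of 1] card_fst_node[OF u k(2)] k by (simp add: rees_le_def)
qed

lemma in_rees_ideal_node:
  assumes u: "u \<in> labelled_perms n j" and k: "1 \<le> k" "k < n"
  shows "in_rees_ideal n j (node u k)"
proof -
  have ul: "u \<in> labelled {1..n}" using u by (simp add: labelled_perms_def)
  have card: "card (fst (node u k)) = k" using card_fst_node[OF ul, of k] k by simp
  moreover have "rees_le (node u k) ({1..n}, j)"
    using rees_le_node[OF ul, of k n] node_labelled_perms_full[OF u] k by simp
  moreover have "snd (node u k) < k" using snd_node_less[OF ul] k by simp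
  moreover have "fst (node u k) \<noteq> {}" "fst (node u k) \<noteq> {1..n}" using card k by auto
  ultimately show ?thesis by (auto simp: in_rees_ideal_def rees_le_def)
qed

lemma nth_eq_of_node_eq:
  assumes u: "u \<in> labelled X" and v: "v \<in> labelled X" and k: "k < card X"
    and eq: "node u k = node v k" "node u (Suc k) = node v (Suc k)"
  shows "u ! k = v ! k"
proof -
  have len: "k < length u" "k < length v" using length_labelled u v k by metis+
  have notin: "fst (w ! k) \<notin> fst ` set (take k w)" if "w \<in> labelled X" for w
  proof -
    have "k < length w" "distinct (map fst w)" using length_labelled[OF that] k that by (auto simp: labelled_def)
    then have "distinct (map fst (take (Suc k) w))" by (metis distinct_take take_map)
    then show ?thesis using \<open>k < length w\<close> by (simp add: take_Suc_conv_app_nth)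
  qed
  have "insert (fst (u ! k)) (fst ` set (take k u)) = insert (fst (v ! k)) (fst ` set (take k v))"
    using eq(2) len by (simp add: node_def take_Suc_conv_app_nth)
  moreover have "fst ` set (take k u) = fst ` set (take k v)" using eq(1) by (simp add: node_def)
  ultimately have "fst (u ! k) = fst (v ! k)"
    using notin[OF u] notin[OF v] by (metis insert_iff)
  moreover have "snd (u ! k) = snd (v ! k)"
    using eq len by (simp add: node_def take_Suc_conv_app_nth)
  ultimately show ?thesis by (rule prod_eqI)
qed

lemma labelled_eqI:
  assumes "u \<in> labelled X" "v \<in> labelled X" "\<And>k. k \<le> card X \<Longrightarrow> node u k = node v k"
  shows "u = v"
  using assms length_labelled[of u X] length_labelled[of v X]
  by (intro nth_equalityI nth_eq_of_node_eq[of u X v]) auto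

lemma node_eq_imp_index_eq:
  assumes "u \<in> labelled X" "v \<in> labelled X" "k \<le> card X" "l \<le> card X" "node u k = node v l"
  shows "k = l"
  using card_fst_node[of u X k] card_fst_node[of v X l] assms by simp

lemma node_inj: "u \<in> labelled_perms n j \<Longrightarrow> inj_on (node u) {1..<n}"
  using node_eq_imp_index_eq[of u "{1..n}" u] by (auto simp: inj_on_def labelled_perms_def)

lemma inj_on_maxchain: "inj_on (maxchain n) (labelled_perms n j)"
proof (rule inj_onI)
  fix u v assume u: "u \<in> labelled_perms n j" and v: "v \<in> labelled_perms n j"
    and eq: "maxchain n u = maxchain n v"
  have ul: "u \<in> labelled {1..n}" and vl: "v \<in> labelled {1..n}" using u v by (simp_all add: labelled_perms_def)
  show "u = v"
  proof (rule labelled_eqI[OF ul vl])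
    fix k assume k: "k \<le> card {1..n}"
    consider "k = 0" | "k = n" | "k \<in> {1..<n}" using k by force
    then show "node u k = node v k"
    proof cases
      case 3
      then have "node u k \<in> maxchain n u" by (simp add: maxchain_def)
      then have "node u k \<in> maxchain n v" by (simp only: eq)
      then obtain l where "l \<in> {1..<n}" "node u k = node v l" by (auto simp: maxchain_def)
      then show ?thesis using node_eq_imp_index_eq[OF ul vl, of k l] 3 by simp
    qed (use node_labelled_perms_full u v in simp_all)
  qed
qed

lemma maxchain_simplex:
  assumes u: "u \<in> labelled_perms n j" and j: "j < n"
  shows "maxchain n u \<in> order_simplices (rees_ideal n j) (int n - 2)"
proof -
  have "(node u k, node u l) \<in> rees_ideal n j" if "k \<in> {1..<n}" "l \<in> {1..<n}" "k \<le> l" for k l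
    using that in_rees_ideal_node[OF u] rees_le_node[of u "{1..n}" k l] u
    by (simp add: rees_ideal_iff[OF j] labelled_perms_def)
  then have "maxchain n u \<in> Chains (rees_ideal n j)"
    unfolding maxchain_def Chains_def by clarify (metis nat_le_linear)
  moreover have "card (maxchain n u) = n - 1"
    using node_inj[OF u] by (simp add: maxchain_def card_image)
  ultimately show ?thesis using j by (simp add: order_simplices_def maxchain_def)
qed

text \<open>Comparable elements with sets of equal size have equal sets, and then the inequality of
  ranks forces equal second coordinates. So a chain has at most n - 1 elements, and n - 2 is the top
  dimension.\<close>

lemma simplex_inj_card:
  assumes c: "c \<in> Chains (rees_ideal n j)" and j: "j < n"
  shows "inj_on (\<lambda>p. card (fst p)) c" "(\<lambda>p. card (fst p)) ` c \<subseteq> {1..<n}"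
proof -
  have in_I: "in_rees_ideal n j p" if "p \<in> c" for p
    using c that rees_ideal_iff[OF j, of p p] by (auto simp: Chains_def)
  have fin: "finite (fst p)" if "p \<in> c" for p
    using in_I[OF that] finite_subset[of "fst p" "{1..n}"] by (auto simp: in_rees_ideal_def)
  show "inj_on (\<lambda>p. card (fst p)) c"
  proof (rule inj_onI)
    fix p q assume pq: "p \<in> c" "q \<in> c" "card (fst p) = card (fst q)"
    then have "rees_le p q \<or> rees_le q p"
      using c rees_ideal_iff[OF j] by (auto simp: Chains_def)
    then show "p = q"
    proof
      assume "rees_le p q"
      then have "fst p = fst q" "snd p = snd q"
        using pq fin card_subset_eq[of "fst q" "fst p"] by (auto simp: rees_le_def)
      then show ?thesis by (rule prod_eqI)
    next
      assume "rees_le q p"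
      then have "fst p = fst q" "snd p = snd q"
        using pq fin card_subset_eq[of "fst p" "fst q"] by (auto simp: rees_le_def)
      then show ?thesis by (rule prod_eqI)
    qed
  qed
  show "(\<lambda>p. card (fst p)) ` c \<subseteq> {1..<n}"
  proof
    fix k assume "k \<in> (\<lambda>p. card (fst p)) ` c"
    then obtain p where p: "p \<in> c" "k = card (fst p)" by blast
    have "fst p \<noteq> {}" "fst p \<subset> {1..n}" using in_I[OF p(1)] by (auto simp: in_rees_ideal_def)
    then show "k \<in> {1..<n}"
      using psubset_card_mono[of "{1..n}" "fst p"] fin[OF p(1)] card_gt_0_iff[of "fst p"] p(2) by auto
  qed
qed

lemma no_bigger_simplices:
  assumes "j < n"
  shows "order_simplices (rees_ideal n j) (int n - 2 + 1) = {}"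
proof -
  have "card c \<le> n - 1" if "c \<in> Chains (rees_ideal n j)" for c
    using simplex_inj_card[OF that assms] by (metis card_image card_mono card_atLeastLessThan finite_atLeastLessThan)
  then show ?thesis using assms by (fastforce simp: order_simplices_def)
qed

lemma exists_list_of_path:
  fixes g :: "nat \<Rightarrow> 'a set \<times> nat"
  assumes g0: "g 0 = ({}, 0)" and le: "\<And>k. k < n \<Longrightarrow> fst (g k) \<subseteq> fst (g (Suc k)) \<and>
      snd (g k) \<le> snd (g (Suc k)) \<and> snd (g (Suc k)) \<le> Suc (snd (g k))"
    and card: "\<And>k. k \<le> n \<Longrightarrow> finite (fst (g k)) \<and> card (fst (g k)) = k"
  shows "\<exists>u. length u = n \<and> (\<forall>k\<le>n. node u k = g k) \<and> (\<forall>p\<in>set u. snd p \<le> 1) \<and> distinct (map fst u)"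
  using le card
proof (induction n)
  case 0
  then show ?case using g0 by simp
next
  case (Suc n)
  then obtain u where u: "length u = n" "\<forall>k\<le>n. node u k = g k" "\<forall>p\<in>set u. snd p \<le> 1" "distinct (map fst u)"
    by (metis le_SucI less_SucI)
  have sub: "fst (g n) \<subseteq> fst (g (Suc n))" using Suc.prems(1) by blast
  have "card (fst (g (Suc n)) - fst (g n)) = 1"
    using Suc.prems(2)[of n] Suc.prems(2)[of "Suc n"] sub by (simp add: card_Diff_subset)
  then obtain x where x: "fst (g (Suc n)) - fst (g n) = {x}" by (auto simp: card_1_singleton_iff)
  define a where "a = snd (g (Suc n)) - snd (g n)"
  have "node u n = g n" using u(2) by simp
  then have full: "fst ` set u = fst (g n)" "label_sum u = snd (g n)"
    using u(1) by (simp_all add: node_def prod_eq_iff)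
  have x': "fst (g (Suc n)) = insert x (fst (g n))" "x \<notin> fst (g n)" using x sub by blast+
  have a: "snd (g (Suc n)) = snd (g n) + a" "a \<le> 1" using Suc.prems(1)[of n] by (auto simp: a_def)
  have "node (u @ [(x, a)]) k = g k" if "k \<le> Suc n" for k
  proof (cases "k = Suc n")
    case True
    then show ?thesis using u(1) full x'(1) a(1) by (simp add: node_def prod_eq_iff)
  next
    case False
    then have "k \<le> n" using that by simp
    then show ?thesis using u(1,2) by (simp add: node_def)
  qed
  then show ?case
    using u full x' a by (intro exI[of _ "u @ [(x, a)]"]) auto
qed

lemma simplex_maxchain:
  assumes c: "c \<in> order_simplices (rees_ideal n j) (int n - 2)" and j: "j < n"
  shows "\<exists>u\<in>labelled_perms n j. c = maxchain n u"
proof -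
  have chain: "c \<in> Chains (rees_ideal n j)" and fin: "finite c" and card_c: "card c = n - 1"
    using c j by (auto simp: order_simplices_def)
  note inj = simplex_inj_card[OF chain j]
  \<comment> \<open>There are n - 1 distinct values within a range of n - 1, so every cardinality
    occurs.\<close>
  have img: "(\<lambda>p. card (fst p)) ` c = {1..<n}"
    using inj card_c by (intro card_subset_eq) (simp_all add: card_image)
  have in_I: "in_rees_ideal n j p" if "p \<in> c" for p
    using chain that rees_ideal_iff[OF j, of p p] by (auto simp: Chains_def)
  define h where "h = inv_into c (\<lambda>p. card (fst p))"
  have h: "h k \<in> c" "card (fst (h k)) = k" if "1 \<le> k" "k < n" for k
    using that img inv_into_into[of k "\<lambda>p. card (fst p)" c] f_inv_into_f[of k "\<lambda>p. card (fst p)" c]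
    by (auto simp: h_def)
  have c_eq: "c = h ` {1..<n}"
    unfolding h_def img[symmetric] using inj(1) by (simp add: inv_into_image_cancel)
  \<comment> \<open>The chain is completed by the virtual bottom and the top of the ideal, so that
    the first and the last label can be read off as differences too.\<close>
  define g where "g k = (if k = 0 then ({}, 0) else if k = n then ({1..n}, j) else h k)" for k
  have g_h: "g k = h k" if "1 \<le> k" "k < n" for k using that by (simp add: g_def)
  have n: "n > 0" using j by simp
  have g_n: "g n = ({1..n}, j)" using n by (simp add: g_def)
  have card_g: "card (fst (g k)) = k" "finite (fst (g k))" if "k \<le> n" for k
  proof -
    consider "k = 0" | "k = n" | "1 \<le> k" "k < n" using \<open>k \<le> n\<close> by linarith
    then have "card (fst (g k)) = k \<and> finite (fst (g k))"
    proof cases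
      case 3
      then have "fst (h k) \<subseteq> {1..n}" using in_I[OF h(1)] by (auto simp: in_rees_ideal_def)
      then show ?thesis using 3 h(2) g_h finite_subset by fastforce
    qed (use n in \<open>simp_all add: g_def\<close>)
    then show "card (fst (g k)) = k" "finite (fst (g k))" by auto
  qed
  have step: "rees_le (g k) (g (Suc k))" if k: "k < n" for k
  proof -
    have snd_h1: "snd (h 1) = 0" if "1 < n"
      using in_I[OF h(1)[of 1]] h(2)[of 1] that by (simp add: in_rees_ideal_def)
    consider "k = 0" "n = 1" | "k = 0" "n > 1" | "1 \<le> k" "Suc k = n" | "1 \<le> k" "Suc k < n"
      using k by linarith
    then show ?thesis
    proof cases
      case 1
      then show ?thesis using j by (simp add: g_def rees_le_def)
    next
      case 2
      then show ?thesis using snd_h1 by (simp add: g_def rees_le_def)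
    next
      case 3
      then show ?thesis using in_I[OF h(1)[of k]] g_h[of k] g_n by (simp add: in_rees_ideal_def)
    next
      case 4
      have "rees_le (h k) (h (Suc k)) \<or> rees_le (h (Suc k)) (h k)"
        using chain h(1)[of k] h(1)[of "Suc k"] 4 rees_ideal_iff[OF j] by (auto simp: Chains_def)
      moreover have "\<not> rees_le (h (Suc k)) (h k)"
      proof
        assume "rees_le (h (Suc k)) (h k)"
        then have "card (fst (h (Suc k))) \<le> card (fst (h k))"
          using card_g[of k] g_h[of k] 4 card_mono by (auto simp: rees_le_def)
        then show False using h(2)[of k] h(2)[of "Suc k"] 4 by simp
      qed
      ultimately show ?thesis using g_h[of k] g_h[of "Suc k"] 4 by simp
    qed
  qed
  have "\<exists>u. length u = n \<and> (\<forall>k\<le>n. node u k = g k) \<and> (\<forall>p\<in>set u. snd p \<le> 1) \<and> distinct (map fst u)"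
  proof (rule exists_list_of_path)
    fix k assume k: "k < n"
    show "fst (g k) \<subseteq> fst (g (Suc k)) \<and> snd (g k) \<le> snd (g (Suc k)) \<and> snd (g (Suc k)) \<le> Suc (snd (g k))"
      using step[OF k] card_g(1)[of k] card_g(1)[of "Suc k"] k by (simp add: rees_le_def)
  qed (use card_g in \<open>simp_all add: g_def\<close>)
  then obtain u where u: "length u = n" "\<forall>k\<le>n. node u k = g k" "\<forall>p\<in>set u. snd p \<le> 1" "distinct (map fst u)"
    by blast
  have full: "fst ` set u = {1..n}" "label_sum u = j"
    using u(1) u(2)[rule_format, of n] g_n by (simp_all add: node_def)
  have "snd (hd u) = 0"
  proof -
    obtain p w where pw: "u = p # w" using u(1) n by (cases u) auto
    then have "snd p = snd (g 1)" using u(2)[rule_format, of 1] n by (simp add: node_def flip: u(2))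
    moreover have "snd (g 1) = 0"
      using step[of 0] card_g(1)[of 1] n in_I[OF h(1)[of 1]] h(2)[of 1] j by (auto simp: g_def in_rees_ideal_def)
    ultimately show ?thesis using pw by simp
  qed
  then have "u \<in> labelled_perms n j"
    using u full by (simp add: labelled_perms_def labelled_def)
  moreover have "c = maxchain n u"
    unfolding c_eq maxchain_def using u(2) g_h by (intro image_cong) auto
  ultimately show ?thesis by blast
qed

lemma order_simplices_rees_ideal:
  "j < n \<Longrightarrow> order_simplices (rees_ideal n j) (int n - 2) = maxchain n ` labelled_perms n j"
  using simplex_maxchain maxchain_simplex by blast

subsection \<open>The cycle condition\<close>

text \<open>The maximal chains through the face of \<open>u\<close> without rank s, \<open>u\<close>
  itself among them. Agreement can be asked for all indices k because at 0 and from n on all members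
  of \<open>labelled_perms n j\<close> have the same node.\<close>

definition neighbours :: "nat \<Rightarrow> nat \<Rightarrow> nat \<Rightarrow> (nat \<times> nat) list \<Rightarrow> (nat \<times> nat) list set" where
  "neighbours n j s u = {v \<in> labelled_perms n j. \<forall>k. k \<noteq> s \<longrightarrow> node v k = node u k}"

lemma finite_labelled_perms: "finite (labelled_perms n j)"
  using finite_labelled[of "{1..n}"] by (auto simp: labelled_perms_def intro: finite_subset)

lemma node_ge_length: "u \<in> labelled_perms n j \<Longrightarrow> n \<le> k \<Longrightarrow> node u k = ({1..n}, j)"
  using length_labelled[of u "{1..n}"] by (auto simp: node_def labelled_perms_def labelled_def)

lemma neighboursI:
  assumes "u \<in> labelled_perms n j" "v \<in> labelled_perms n j"
    and "\<And>k. k \<in> {1..<n} \<Longrightarrow> k \<noteq> s \<Longrightarrow> node v k = node u k"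
  shows "v \<in> neighbours n j s u"
proof -
  have "node v k = node u k" if "k \<noteq> s" for k
  proof -
    consider "k = 0" | "k \<in> {1..<n}" | "n \<le> k" by force
    then show ?thesis
      using assms(3)[of k] that node_ge_length[OF assms(1), of k] node_ge_length[OF assms(2), of k]
      by cases simp_all
  qed
  then show ?thesis using assms(2) by (simp add: neighbours_def)
qed

text \<open>Cardinality tells the elements of a maximal chain apart, so a face determines the rank
  it misses; two chains sharing it both miss s.\<close>

lemma maxchain_remove_eq:
  assumes u: "u \<in> labelled_perms n j" and v: "v \<in> labelled_perms n j" and s: "s \<in> {1..<n}"
  shows "{x \<in> maxchain n v. maxchain n v - {x} = maxchain n u - {node u s}} =
    (if v \<in> neighbours n j s u then {node v s} else {})"
proof -
  have ul: "u \<in> labelled {1..n}" and vl: "v \<in> labelled {1..n}" using u v by (simp_all add: labelled_perms_def)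
  have remove: "maxchain n w - {node w k} = node w ` ({1..<n} - {k})"
    if "w \<in> labelled_perms n j" "k \<in> {1..<n}" for w k
    using inj_on_image_set_diff[OF node_inj[OF that(1)], of "{1..<n}" "{k}"] that(2)
    by (simp add: maxchain_def)
  have A: "v \<in> neighbours n j s u \<and> k = s"
    if k: "k \<in> {1..<n}" and eq: "maxchain n v - {node v k} = maxchain n u - {node u s}" for k
  proof -
    have eq': "node v ` ({1..<n} - {k}) = node u ` ({1..<n} - {s})"
      using eq remove[OF v k] remove[OF u s] by simp
    have same: "node v l = node u l \<and> l \<noteq> s" if "l \<in> {1..<n} - {k}" for l
    proof -
      have "node v l \<in> node u ` ({1..<n} - {s})" unfolding eq'[symmetric] using that by (rule imageI)
      then obtain l' where l': "l' \<in> {1..<n} - {s}" "node v l = node u l'" by blast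
      then have "l = l'" using node_eq_imp_index_eq[OF vl ul, of l l'] that by simp
      then show ?thesis using l' by simp
    qed
    have ks: "k = s"
    proof (rule ccontr)
      assume "k \<noteq> s"
      then have "s \<in> {1..<n} - {k}" using s by simp
      then show False using same by blast
    qed
    have "v \<in> neighbours n j s u"
      by (rule neighboursI[OF u v]) (use same ks in simp)
    then show ?thesis using ks by simp
  qed
  have B: "maxchain n v - {node v s} = maxchain n u - {node u s}" if "v \<in> neighbours n j s u"
    unfolding remove[OF v s] remove[OF u s] using that by (intro image_cong) (auto simp: neighbours_def)
  have C: "node v s \<in> maxchain n v" using s by (simp add: maxchain_def)
  have "x \<in> maxchain n v \<and> maxchain n v - {x} = maxchain n u - {node u s} \<longleftrightarrow>
      v \<in> neighbours n j s u \<and> x = node v s" for x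
  proof
    assume x: "x \<in> maxchain n v \<and> maxchain n v - {x} = maxchain n u - {node u s}"
    then obtain k where k: "k \<in> {1..<n}" "x = node v k" by (auto simp: maxchain_def)
    then show "v \<in> neighbours n j s u \<and> x = node v s" using A[OF k(1)] x by simp
  qed (use B C in simp)
  then show ?thesis by simp
qed

text \<open>The sign of a deleted element depends on s alone, so all chains through a common face
  carry the same sign and it factors out of the boundary. The value is s - 1 since chains of the
  ideal start at index 1.\<close>

lemma card_underS_maxchain:
  assumes v: "v \<in> labelled_perms n j" and s: "s \<in> {1..<n}" and j: "j < n"
  shows "card (underS (rees_ideal n j) (node v s) \<inter> maxchain n v) = s - 1"
proof -
  have vl: "v \<in> labelled {1..n}" using v by (simp add: labelled_perms_def)
  have rel: "(node v k, node v s) \<in> rees_ideal n j \<longleftrightarrow> k \<le> s" if k: "k \<in> {1..<n}" for k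
  proof
    assume "(node v k, node v s) \<in> rees_ideal n j"
    then have "fst (node v k) \<subseteq> fst (node v s)" by (simp add: rees_ideal_iff[OF j] rees_le_def)
    moreover have "finite (fst (node v s))" by (simp add: node_def)
    ultimately have "card (fst (node v k)) \<le> card (fst (node v s))" by (rule card_mono[rotated])
    then show "k \<le> s" using card_fst_node[OF vl] k s by simp
  next
    assume "k \<le> s"
    then show "(node v k, node v s) \<in> rees_ideal n j"
      using in_rees_ideal_node[OF v, of k] in_rees_ideal_node[OF v, of s] rees_le_node[OF vl, of k s] k s
      by (simp add: rees_ideal_iff[OF j])
  qed
  have neq: "node v k = node v s \<longleftrightarrow> k = s" if "k \<in> {1..<n}" for k
    using node_eq_imp_index_eq[OF vl vl, of k s] that s by auto
  have "x \<in> underS (rees_ideal n j) (node v s) \<inter> maxchain n v \<longleftrightarrow> x \<in> node v ` {1..<s}" for x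
  proof
    assume "x \<in> underS (rees_ideal n j) (node v s) \<inter> maxchain n v"
    then obtain k where k: "k \<in> {1..<n}" "x = node v k" "x \<noteq> node v s" "(x, node v s) \<in> rees_ideal n j"
      by (auto simp: maxchain_def underS_def)
    then have "k < s" using rel[OF k(1)] neq[OF k(1)] by auto
    then show "x \<in> node v ` {1..<s}" using k by auto
  next
    assume "x \<in> node v ` {1..<s}"
    then obtain k where k: "k \<in> {1..<s}" "x = node v k" by blast
    then have "k \<in> {1..<n}" using s by simp
    then show "x \<in> underS (rees_ideal n j) (node v s) \<inter> maxchain n v"
      using k rel[of k] neq[of k] by (simp add: underS_def maxchain_def)
  qed
  then have "underS (rees_ideal n j) (node v s) \<inter> maxchain n v = node v ` {1..<s}" by blast
  moreover have "inj_on (node v) {1..<s}"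
    using s by (intro inj_on_subset[OF node_inj[OF v]]) auto
  ultimately show ?thesis by (simp add: card_image)
qed

lemma boundary_maxchain:
  assumes f: "f \<in> carrier (chain_space (rees_ideal n j) (int n - 2))" and j: "j < n"
  shows "boundary (rees_ideal n j) f t = (\<Sum>v\<in>labelled_perms n j.
    \<Sum>x | x \<in> maxchain n v \<and> maxchain n v - {x} = t.
      (-1) ^ card (underS (rees_ideal n j) x \<inter> maxchain n v) * f (maxchain n v))"
proof -
  have "{c. f c \<noteq> 0} \<subseteq> maxchain n ` labelled_perms n j"
    using f order_simplices_rees_ideal[OF j] by (simp add: chain_space_def)
  then show ?thesis
    by (subst boundary_eq_sum[of "maxchain n ` labelled_perms n j"])
      (simp_all add: finite_labelled_perms sum.reindex[OF inj_on_maxchain] o_def)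
qed

lemma boundary_face:
  assumes f: "f \<in> carrier (chain_space (rees_ideal n j) (int n - 2))" and j: "j < n"
    and u: "u \<in> labelled_perms n j" and s: "s \<in> {1..<n}"
  shows "boundary (rees_ideal n j) f (maxchain n u - {node u s}) =
    (-1) ^ (s - 1) * (\<Sum>v\<in>neighbours n j s u. f (maxchain n v))"
proof -
  let ?N = "neighbours n j s u"
  have "boundary (rees_ideal n j) f (maxchain n u - {node u s}) =
      (\<Sum>v\<in>labelled_perms n j. if v \<in> ?N then (-1) ^ (s - 1) * f (maxchain n v) else 0)"
    unfolding boundary_maxchain[OF f j]
  proof (rule sum.cong[OF refl])
    fix v assume v: "v \<in> labelled_perms n j"
    show "(\<Sum>x | x \<in> maxchain n v \<and> maxchain n v - {x} = maxchain n u - {node u s}.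
        (-1) ^ card (underS (rees_ideal n j) x \<inter> maxchain n v) * f (maxchain n v)) =
      (if v \<in> ?N then (-1) ^ (s - 1) * f (maxchain n v) else 0)"
      unfolding maxchain_remove_eq[OF u v s] by (simp add: card_underS_maxchain[OF v s j])
  qed
  also have "\<dots> = (\<Sum>v\<in>?N. (-1) ^ (s - 1) * f (maxchain n v))"
    using finite_labelled_perms[of n j]
    by (subst sum.If_cases) (auto simp: neighbours_def intro!: sum.cong)
  finally show ?thesis by (simp add: sum_distrib_left)
qed

text \<open>The local sums are, up to sign, the values of the boundary at the faces of codimension
  one; at any other set the boundary has no terms.\<close>

lemma cycles_rees_ideal_iff:
  assumes f: "f \<in> carrier (chain_space (rees_ideal n j) (int n - 2))" and j: "j < n"
  shows "f \<in> cycles (rees_ideal n j) (int n - 2) \<longleftrightarrow>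
    (\<forall>u\<in>labelled_perms n j. \<forall>s\<in>{1..<n}. (\<Sum>v\<in>neighbours n j s u. f (maxchain n v)) = 0)"
proof
  assume "f \<in> cycles (rees_ideal n j) (int n - 2)"
  then have "boundary (rees_ideal n j) f t = 0" for t by (simp add: cycles_def)
  then show "\<forall>u\<in>labelled_perms n j. \<forall>s\<in>{1..<n}. (\<Sum>v\<in>neighbours n j s u. f (maxchain n v)) = 0"
    using boundary_face[OF f j] by (metis mult_eq_0_iff power_eq_0_iff neg_equal_0_iff_equal zero_neq_one)
next
  assume *: "\<forall>u\<in>labelled_perms n j. \<forall>s\<in>{1..<n}. (\<Sum>v\<in>neighbours n j s u. f (maxchain n v)) = 0"
  have "boundary (rees_ideal n j) f t = 0" for t
  proof (cases "\<exists>u\<in>labelled_perms n j. \<exists>s\<in>{1..<n}. t = maxchain n u - {node u s}")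
    case True
    then show ?thesis using boundary_face[OF f j] * by fastforce
  next
    case False
    have empty: "{x \<in> maxchain n v. maxchain n v - {x} = t} = {}" if v: "v \<in> labelled_perms n j" for v
    proof (rule ccontr)
      assume "{x \<in> maxchain n v. maxchain n v - {x} = t} \<noteq> {}"
      then obtain x where x: "x \<in> maxchain n v" "maxchain n v - {x} = t" by blast
      then obtain k where "k \<in> {1..<n}" "x = node v k" by (auto simp: maxchain_def)
      then show False using False x v by blast
    qed
    show ?thesis
      unfolding boundary_maxchain[OF f j]
    proof (rule sum.neutral, rule ballI)
      fix v assume "v \<in> labelled_perms n j"
      then show "(\<Sum>x | x \<in> maxchain n v \<and> maxchain n v - {x} = t.
          (-1) ^ card (underS (rees_ideal n j) x \<inter> maxchain n v) * f (maxchain n v)) = 0"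
        by (simp only: empty sum.empty)
    qed
  qed
  then show "f \<in> cycles (rees_ideal n j) (int n - 2)"
    using f by (simp add: cycles_def fun_eq_iff)
qed

subsection \<open>Cycles are determined by falling chains\<close>

lemma not_successively_split:
  "\<not> successively P xs \<Longrightarrow> \<exists>p a b q. xs = p @ a # b # q \<and> \<not> P a b"
proof (induction P xs rule: successively.induct)
  case (3 P x y xs)
  then show ?case
  proof (cases "P x y")
    case True
    then obtain p a b q where "y # xs = p @ a # b # q" "\<not> P a b" using 3 by auto
    then show ?thesis by (metis append_Cons)
  next
    case False
    then show ?thesis by (metis append_Nil)
  qed
qed simp_all

lemma append_Cons_less: "a < b \<Longrightarrow> p @ a # q < p @ (b :: 'a :: linorder) # r"
  by (induction p) simp_all

lemma split_at:
  assumes "Suc i < length u"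
  shows "\<exists>p x \<alpha> y \<beta> q. u = p @ (x, \<alpha>) # (y, \<beta>) # q \<and> length p = i"
proof -
  have "u = take i u @ u ! i # u ! Suc i # drop (Suc (Suc i)) u"
    using assms by (metis Cons_nth_drop_Suc Suc_lessD append_take_drop_id)
  moreover have "length (take i u) = i" using assms by simp
  ultimately show ?thesis by (metis surj_pair)
qed

lemma node_append: "k \<le> length p \<Longrightarrow> node (p @ w) k = node p k"
  by (simp add: node_def)

lemma node_middle:
  "node (p @ (x, \<alpha>) # w) (Suc (length p)) = (insert x (fst ` set p), label_sum p + \<alpha>)"
  by (simp add: node_def)

lemma node_after:
  "node (p @ (x, \<alpha>) # (y, \<beta>) # w) (Suc (Suc (length p + k))) =
    (insert x (insert y (fst ` set p \<union> fst ` set (take k w))), label_sum p + (\<alpha> + \<beta>) + label_sum (take k w))"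
proof -
  have "Suc (Suc (length p + k)) - length p = Suc (Suc k)" by simp
  then show ?thesis by (auto simp: node_def)
qed

text \<open>Only the node between two adjacent entries sees how their letters and labels are
  distributed; later nodes see the set of letters and the sum of labels.\<close>

lemma node_exchange:
  assumes "{x, y} = {x', y'}" "\<alpha> + \<beta> = \<alpha>' + \<beta>'" "k \<noteq> Suc (length p)"
  shows "node (p @ (x, \<alpha>) # (y, \<beta>) # q) k = node (p @ (x', \<alpha>') # (y', \<beta>') # q) k"
proof (cases "k \<le> length p")
  case True
  then show ?thesis by (simp add: node_append)
next
  case False
  then obtain l where "k = Suc (Suc (length p + l))"
    using assms(3) by (metis Suc_leI le_add_diff_inverse add_Suc_right add_Suc not_less le_neq_implies_less less_Suc_eq_le not_less_eq)
  then show ?thesis using assms(1,2) by (simp only: node_after) auto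
qed

text \<open>The nodes on both sides of the free rank fix the pair of letters and the sum of the two
  labels, and every other entry is determined by two consecutive nodes that remain.\<close>

lemma neighbours_split:
  assumes u: "p @ (x, \<alpha>) # (y, \<beta>) # q \<in> labelled_perms n j"
    and v: "v \<in> neighbours n j (Suc (length p)) (p @ (x, \<alpha>) # (y, \<beta>) # q)"
  shows "\<exists>x' \<alpha>' y' \<beta>'. v = p @ (x', \<alpha>') # (y', \<beta>') # q \<and> \<alpha>' \<le> 1 \<and> \<beta>' \<le> 1 \<and>
    \<alpha>' + \<beta>' = \<alpha> + \<beta> \<and> (x' = x \<and> y' = y \<or> x' = y \<and> y' = x)"
proof -
  let ?u = "p @ (x, \<alpha>) # (y, \<beta>) # q"
  have ul: "?u \<in> labelled {1..n}" and vl: "v \<in> labelled {1..n}"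
    using u v by (simp_all add: labelled_perms_def neighbours_def)
  have len: "length v = length ?u" "length ?u = n" using length_labelled[OF ul] length_labelled[OF vl] by simp_all
  have nodes: "node v k = node ?u k" if "k \<noteq> Suc (length p)" for k
    using v that by (simp add: neighbours_def)
  have nth: "v ! k = ?u ! k" if "k < n" "k \<noteq> length p" "k \<noteq> Suc (length p)" for k
    using nth_eq_of_node_eq[OF vl ul, of k] nodes[of k] nodes[of "Suc k"] that by simp
  obtain x' \<alpha>' y' \<beta>' where xy: "v ! length p = (x', \<alpha>')" "v ! Suc (length p) = (y', \<beta>')" by (metis surj_pair)
  have v_eq: "v = p @ (x', \<alpha>') # (y', \<beta>') # q"
  proof (rule nth_equalityI)
    fix k assume k: "k < length v"
    show "v ! k = (p @ (x', \<alpha>') # (y', \<beta>') # q) ! k"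
    proof (cases "k = length p \<or> k = Suc (length p)")
      case True
      then show ?thesis using xy by (auto simp: nth_append)
    next
      case False
      then show ?thesis using nth[of k] k len by (auto simp: nth_append nth_Cons' )
    qed
  qed (use len in simp)
  have labels: "\<alpha>' \<le> 1" "\<beta>' \<le> 1" using vl unfolding v_eq by (auto simp: labelled_def)
  have eq2: "node v (Suc (Suc (length p + 0))) = node ?u (Suc (Suc (length p + 0)))" by (rule nodes) simp
  then have letters: "insert x' (insert y' (fst ` set p)) = insert x (insert y (fst ` set p))"
    and sums: "\<alpha>' + \<beta>' = \<alpha> + \<beta>"
    unfolding v_eq node_after by simp_all
  have "x \<notin> fst ` set p" "y \<notin> fst ` set p" "x \<noteq> y" "x' \<notin> fst ` set p" "y' \<notin> fst ` set p" "x' \<noteq> y'"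
    using ul vl unfolding v_eq by (auto simp: labelled_def)
  then have "x' = x \<and> y' = y \<or> x' = y \<and> y' = x" using letters by (metis insert_iff)
  then show ?thesis using v_eq labels sums by blast
qed

text \<open>The lexicographically largest chain w with nonzero coefficient would have an ascending
  pair. All other fillings of that rank are larger than w, so the local equation reduces to the
  single term of w.\<close>

lemma cycle_eq_zero_of_zero_on_falling:
  fixes g :: "(nat \<times> nat) list \<Rightarrow> complex"
  assumes cyc: "\<And>u s. u \<in> labelled_perms n j \<Longrightarrow> s \<in> {1..<n} \<Longrightarrow> (\<Sum>v\<in>neighbours n j s u. g v) = 0"
    and zero: "\<And>u. u \<in> falling {1..n} \<Longrightarrow> label_sum u = j \<Longrightarrow> g u = 0"
    and u: "u \<in> labelled_perms n j"
  shows "g u = 0"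
proof (rule ccontr)
  assume "g u \<noteq> 0"
  define B where "B = {u \<in> labelled_perms n j. g u \<noteq> 0}"
  have B: "finite B" "B \<noteq> {}" using finite_labelled_perms[of n j] u \<open>g u \<noteq> 0\<close> by (auto simp: B_def)
  define w where "w = Max B"
  have "w \<in> B" using B unfolding w_def by (rule Max_in)
  then have w: "w \<in> labelled_perms n j" "g w \<noteq> 0" by (simp_all add: B_def)
  have max: "g v = 0" if "v \<in> labelled_perms n j" "w < v" for v
  proof (rule ccontr)
    assume "g v \<noteq> 0"
    then have "v \<le> w" using that(1) B(1) unfolding w_def by (intro Max_ge) (simp_all add: B_def)
    then show False using that(2) by simp
  qed
  have "\<not> successively falling_pair w"
    using zero[of w] w by (auto simp: labelled_perms_def falling_def)
  then obtain p a b q where pq: "w = p @ a # b # q" "\<not> falling_pair a b"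
    using not_successively_split by blast
  obtain x \<alpha> y \<beta> where ab: "a = (x, \<alpha>)" "b = (y, \<beta>)" by (metis surj_pair)
  have xy: "x < y" "\<not> (\<alpha> = 1 \<and> \<beta> = 0)" using pq(2) by (auto simp: ab falling_pair_def)
  have w_eq: "w = p @ (x, \<alpha>) # (y, \<beta>) # q" using pq ab by simp
  let ?s = "Suc (length p)"
  have "length w = n" using w length_labelled[of w "{1..n}"] by (simp add: labelled_perms_def)
  then have s: "?s \<in> {1..<n}" by (simp add: w_eq)
  have labels: "\<alpha> \<le> 1" "\<beta> \<le> 1" using w(1) unfolding w_eq by (auto simp: labelled_perms_def labelled_def)
  have "g v = 0" if v: "v \<in> neighbours n j ?s w - {w}" for v
  proof -
    have vM: "v \<in> labelled_perms n j" and "v \<in> neighbours n j ?s w" "v \<noteq> w" using v by (auto simp: neighbours_def)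
    then obtain x' \<alpha>' y' \<beta>' where v': "v = p @ (x', \<alpha>') # (y', \<beta>') # q" "\<alpha>' \<le> 1" "\<beta>' \<le> 1"
      "\<alpha>' + \<beta>' = \<alpha> + \<beta>" "x' = x \<and> y' = y \<or> x' = y \<and> y' = x"
      using neighbours_split w(1) unfolding w_eq by blast
    have "(x, \<alpha>) < (x', \<alpha>')"
    proof (cases "x' = x")
      case True
      then have "y' = y" using v'(5) xy(1) by auto
      then have "\<alpha>' \<noteq> \<alpha>" using \<open>v \<noteq> w\<close> v'(1,4) True by (auto simp: w_eq)
      then have "\<alpha> < \<alpha>'" using labels v'(2-4) xy(2) by linarith
      then show ?thesis using True by simp
    next
      case False
      then have "x < x'" using v'(5) xy(1) by auto
      then show ?thesis by simp
    qed
    then have "w < v" unfolding w_eq v'(1) by (rule append_Cons_less)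
    then show ?thesis using max vM by blast
  qed
  moreover have "w \<in> neighbours n j ?s w" using w by (simp add: neighbours_def)
  moreover have "finite (neighbours n j ?s w)"
    using finite_labelled_perms[of n j] by (simp add: neighbours_def)
  ultimately have "(\<Sum>v\<in>neighbours n j ?s w. g v) = g w"
    by (subst sum.remove[of _ w]) simp_all
  then show False using cyc[OF w(1) s] w(2) by simp
qed

text \<open>Back substitution from a largest key m: no \<open>G u m\<close> with
  \<open>u \<noteq> m\<close> is nonzero, so the coefficient of m can be chosen to suit the
  remaining solution. Keys may coincide; this matters because falling chains with the same letters
  but different labels share the key \<open>map fst\<close>.\<close>

lemma triangular_interpolation:
  fixes G :: "'d \<Rightarrow> 'd \<Rightarrow> 'k :: field" and key :: "'d \<Rightarrow> 'o :: linorder"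
  assumes "finite D" "\<And>u. u \<in> D \<Longrightarrow> G u u \<noteq> 0"
    and "\<And>u v. u \<in> D \<Longrightarrow> v \<in> D \<Longrightarrow> G u v \<noteq> 0 \<Longrightarrow> v = u \<or> key v < key u"
  shows "\<exists>c. \<forall>v\<in>D. (\<Sum>u\<in>D. c u * G u v) = g v"
  using assms
proof (induction D arbitrary: g rule: finite_psubset_induct)
  case (psubset D)
  show ?case
  proof (cases "D = {}")
    case False
    then have "Max (key ` D) \<in> key ` D" using psubset.hyps by (intro Max_in) simp_all
    then obtain m where m: "m \<in> D" "key m = Max (key ` D)" by (metis imageE)
    have zero: "G u m = 0" if "u \<in> D - {m}" for u
    proof (rule ccontr)
      assume "G u m \<noteq> 0"
      then have "key m < key u" using psubset.prems(2)[of u m] m(1) that by auto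
      moreover have "key u \<le> key m" using psubset.hyps that m(2) by simp
      ultimately show False by simp
    qed
    define a where "a = g m / G m m"
    have "\<exists>c. \<forall>v\<in>D - {m}. (\<Sum>u\<in>D - {m}. c u * G u v) = g v - a * G m v"
    proof (rule psubset.IH)
      show "D - {m} \<subset> D" using m(1) by blast
    qed (use psubset.prems in blast)+
    then obtain c where c: "\<And>v. v \<in> D - {m} \<Longrightarrow> (\<Sum>u\<in>D - {m}. c u * G u v) = g v - a * G m v" by blast
    have "(\<Sum>u\<in>D. (c(m := a)) u * G u v) = g v" if v: "v \<in> D" for v
    proof -
      have "(\<Sum>u\<in>D. (c(m := a)) u * G u v) = a * G m v + (\<Sum>u\<in>D - {m}. (c(m := a)) u * G u v)"
        using psubset.hyps m(1) by (subst sum.remove[of _ m]) simp_all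
      also have "(\<Sum>u\<in>D - {m}. (c(m := a)) u * G u v) = (\<Sum>u\<in>D - {m}. c u * G u v)"
        by (intro sum.cong) simp_all
      also have "\<dots> = g v - a * G m v"
      proof (cases "v = m")
        case True
        then show ?thesis using zero psubset.prems(1)[OF m(1)] by (simp add: a_def)
      qed (use c v in simp)
      finally show ?thesis by simp
    qed
    then show ?thesis by blast
  qed simp
qed

text \<open>Fixed points of h are permitted, since there \<open>g v = - g v\<close>. They do occur:
  exchanging equal labels changes nothing.\<close>

lemma sum_involution_eq_zero:
  fixes g :: "'d \<Rightarrow> 'k :: field_char_0"
  assumes "\<And>v. v \<in> N \<Longrightarrow> h v \<in> N" "\<And>v. v \<in> N \<Longrightarrow> h (h v) = v" "\<And>v. v \<in> N \<Longrightarrow> g (h v) = - g v"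
  shows "sum g N = 0"
proof -
  have "sum g N = (\<Sum>v\<in>N. g (h v))"
    by (rule sum.reindex_bij_witness[of N h h]) (use assms in auto)
  also have "\<dots> = - sum g N" using assms(3) by (simp add: sum_negf)
  finally show ?thesis by (simp add: eq_neg_iff_add_eq_0)
qed

subsection \<open>Fundamental cycles\<close>

text \<open>Only the parity counts: for permutations of a fixed set it is the sign up to a global
  factor.\<close>

primrec noninv :: "'a::linorder list \<Rightarrow> nat" where
  "noninv [] = 0"
| "noninv (x # xs) = length (filter (\<lambda>y. x < y) xs) + noninv xs"

lemma sign_noninv_swap:
  "x \<noteq> y \<Longrightarrow> (-1 :: complex) ^ noninv (p @ y # x # q) = - ((-1) ^ noninv (p @ x # y # q))"
proof (induction p)
  case Nil
  then show ?case by (cases "x < y") (auto simp: power_add)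
next
  case (Cons z p)
  have "length (filter (\<lambda>w. z < w) (p @ y # x # q)) = length (filter (\<lambda>w. z < w) (p @ x # y # q))"
    by simp
  then show ?case using Cons by (simp only: append_Cons noninv.simps power_add) simp
qed

text \<open>Indexed by ranks: node k lies between the list entries k - 1 and k.\<close>

definition ascents :: "('a::linorder \<times> nat) list \<Rightarrow> nat set" where
  "ascents u = {k. 1 \<le> k \<and> k < length u \<and> fst (u ! (k - 1)) < fst (u ! k)}"

definition compatible :: "nat \<Rightarrow> (nat \<times> nat) list \<Rightarrow> (nat \<times> nat) list \<Rightarrow> bool" where
  "compatible n u v \<longleftrightarrow> (\<forall>k\<in>{1..<n}. if k \<in> ascents u then fst (node v k) = fst (node u k)
     else snd (node v k) = snd (node u k))"

text \<open>The exponent has one summand for each exchange. Swapping adjacent letters changes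
  \<open>noninv\<close> by one and no second coordinate; swapping adjacent labels 0 and 1 changes
  one second coordinate by one and no letter.\<close>

definition fundamental_cycle :: "nat \<Rightarrow> (nat \<times> nat) list \<Rightarrow> (nat \<times> nat) list \<Rightarrow> complex" where
  "fundamental_cycle n u v =
     (if compatible n u v then (-1) ^ (noninv (map fst v) + (\<Sum>k<n. snd (node v k))) else 0)"

text \<open>Swapping the letters around a rank that is not an ascent of \<open>u\<close>, respectively the labels around
  one that is, reverses the sign of the fundamental cycle of \<open>u\<close>; this makes the local sums vanish.\<close>

definition swap_letters :: "nat \<Rightarrow> ('a \<times> nat) list \<Rightarrow> ('a \<times> nat) list" where
  "swap_letters i v =
     take i v @ (fst (v ! Suc i), snd (v ! i)) # (fst (v ! i), snd (v ! Suc i)) # drop (Suc (Suc i)) v"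

definition swap_labels :: "nat \<Rightarrow> ('a \<times> nat) list \<Rightarrow> ('a \<times> nat) list" where
  "swap_labels i v =
     take i v @ (fst (v ! i), snd (v ! Suc i)) # (fst (v ! Suc i), snd (v ! i)) # drop (Suc (Suc i)) v"

lemma swap_letters_append:
  "swap_letters (length p) (p @ (x, \<alpha>) # (y, \<beta>) # q) = p @ (y, \<alpha>) # (x, \<beta>) # q"
  by (simp add: swap_letters_def nth_append)

lemma swap_labels_append:
  "swap_labels (length p) (p @ (x, \<alpha>) # (y, \<beta>) # q) = p @ (x, \<beta>) # (y, \<alpha>) # q"
  by (simp add: swap_labels_def nth_append)

lemma snd_node_Suc: "k < length u \<Longrightarrow> snd (node u (Suc k)) = snd (node u k) + snd (u ! k)"
  by (simp add: node_def take_Suc_conv_app_nth)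

lemma fst_node: "fst (node u k) = set (take k (map fst u))"
  by (simp add: node_def take_map)

text \<open>The label between two adjacent ascents would have to be 0 and 1 at once, and an ascent
  at rank 1 would need first label 1. So \<open>compatible\<close> controls the second coordinate at
  the proper ranks next to an ascent.\<close>

lemma falling_labels_at_ascent:
  assumes u: "u \<in> falling X" and k: "k \<in> ascents u"
  shows "snd (u ! (k - 1)) = 1" "snd (u ! k) = 0" "2 \<le> k" "k - 1 \<notin> ascents u" "Suc k \<notin> ascents u"
proof -
  have labels: "snd (u ! (k - 1)) = 1 \<and> snd (u ! k) = 0" if "k \<in> ascents u" for k
  proof -
    have "Suc (k - 1) = k" "k < length u" "fst (u ! (k - 1)) < fst (u ! k)" using that by (simp_all add: ascents_def)
    moreover have "successively falling_pair u" using u by (simp add: falling_def)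
    ultimately show ?thesis by (metis successively_conv_nth falling_pair_def)
  qed
  show 1: "snd (u ! (k - 1)) = 1" and 2: "snd (u ! k) = 0" using labels[OF k] by simp_all
  show "k - 1 \<notin> ascents u" using labels[of "k - 1"] 1 by auto
  show "Suc k \<notin> ascents u" using labels[of "Suc k"] 2 by auto
  have "u \<noteq> []" using k by (auto simp: ascents_def)
  then have "snd (u ! 0) = 0" using u by (simp add: falling_def labelled_def hd_conv_nth)
  then have "k - 1 \<noteq> 0" using 1 by (intro notI) simp
  then show "2 \<le> k" by simp
qed

section \<open>Sign reversal under the two exchanges\<close>

lemma compatible_cong:
  assumes "\<And>k. k \<in> ascents u \<Longrightarrow> fst (node v k) = fst (node v' k)"
    and "\<And>k. k \<notin> ascents u \<Longrightarrow> snd (node v k) = snd (node v' k)"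
  shows "compatible n u v \<longleftrightarrow> compatible n u v'"
  using assms by (simp add: compatible_def cong: ball_cong if_cong)

text \<open>Only the set at the rank in between changes, and there \<open>compatible\<close> looks
  at the second coordinate. So compatibility persists and the sign comes from
  \<open>noninv\<close>.\<close>

lemma fundamental_cycle_swap_letters:
  assumes "x \<noteq> y" and s: "Suc (length p) \<notin> ascents u"
  shows "fundamental_cycle n u (p @ (y, \<alpha>) # (x, \<beta>) # q) = - fundamental_cycle n u (p @ (x, \<alpha>) # (y, \<beta>) # q)"
proof -
  let ?v = "p @ (x, \<alpha>) # (y, \<beta>) # q" and ?v' = "p @ (y, \<alpha>) # (x, \<beta>) # q"
  have node: "node ?v' k = node ?v k" if "k \<noteq> Suc (length p)" for k
    using that by (intro node_exchange) auto
  have snd: "snd (node ?v' k) = snd (node ?v k)" for k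
    using node[of k] by (cases "k = Suc (length p)") (simp_all add: node_middle)
  have "compatible n u ?v' \<longleftrightarrow> compatible n u ?v"
  proof (rule compatible_cong)
    fix k assume "k \<in> ascents u"
    then have "k \<noteq> Suc (length p)" using s by blast
    then show "fst (node ?v' k) = fst (node ?v k)" by (metis node)
  qed (rule snd)
  moreover have "(-1 :: complex) ^ noninv (map fst ?v') = - ((-1) ^ noninv (map fst ?v))"
    using sign_noninv_swap[OF assms(1), of "map fst p" "map fst q"] by simp
  ultimately show ?thesis
    unfolding fundamental_cycle_def snd by (simp only: power_add) simp
qed

text \<open>The sign reverses only if the labels are 0 and 1. Compatibility ensures this: at the
  ranks before and after the ascent the second coordinates agree with those of u, where they differ
  by exactly 1. If v is not compatible, both sides vanish.\<close>

lemma fundamental_cycle_swap_labels: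
  assumes u: "u \<in> falling {1..n}" "u \<in> labelled_perms n j" and s: "Suc (length p) \<in> ascents u"
    and v: "p @ (x, \<alpha>) # (y, \<beta>) # q \<in> labelled_perms n j"
  shows "fundamental_cycle n u (p @ (x, \<beta>) # (y, \<alpha>) # q) = - fundamental_cycle n u (p @ (x, \<alpha>) # (y, \<beta>) # q)"
proof -
  let ?s = "Suc (length p)" and ?v = "p @ (x, \<alpha>) # (y, \<beta>) # q" and ?v' = "p @ (x, \<beta>) # (y, \<alpha>) # q"
  have node: "node ?v' k = node ?v k" if "k \<noteq> ?s" for k
    using that by (intro node_exchange) auto
  have "fst (node ?v' k) = fst (node ?v k)" for k
    using node[of k] by (cases "k = ?s") (simp_all add: node_middle)
  moreover have "snd (node ?v' k) = snd (node ?v k)" if "k \<notin> ascents u" for k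
    using that s by (intro arg_cong[of _ _ snd] node) auto
  ultimately have compat: "compatible n u ?v' \<longleftrightarrow> compatible n u ?v" by (intro compatible_cong)
  show ?thesis
  proof (cases "compatible n u ?v")
    case True
    have len: "length u = n" using u(2) length_labelled[of u "{1..n}"] by (simp add: labelled_perms_def)
    have s_less: "?s < n" using s len by (simp add: ascents_def)
    note fl = falling_labels_at_ascent[OF u(1) s]
    have "length p \<in> {1..<n}" "length p \<notin> ascents u" using fl(3,4) s_less by simp_all
    then have before: "snd (node ?v (length p)) = snd (node u (length p))"
      using True by (simp add: compatible_def)
    \<comment> \<open>\<open>compatible\<close> says nothing at index n; there the common label sum
      j takes over.\<close>
    have after: "snd (node ?v (Suc ?s)) = snd (node u (Suc ?s))"
    proof (cases "Suc ?s = n")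
      case True
      then show ?thesis using node_labelled_perms_full[OF u(2)] node_labelled_perms_full[OF v] by simp
    next
      case False
      then have "Suc ?s \<in> {1..<n}" using s_less by simp
      then show ?thesis using \<open>compatible n u ?v\<close> fl(5) unfolding compatible_def by metis
    qed
    have "snd (node u (Suc ?s)) = snd (node u (length p)) + 1"
      using fl(1,2) s_less len snd_node_Suc[of "length p" u] snd_node_Suc[of ?s u] by simp
    moreover have "snd (node ?v (Suc ?s)) = snd (node ?v (length p)) + (\<alpha> + \<beta>)"
      using node_after[of p x \<alpha> y \<beta> q 0] by (simp add: node_def)
    ultimately have ab: "\<alpha> + \<beta> = 1" using before after by simp
    have sum_split: "(\<Sum>k<n. snd (node w k)) = snd (node w ?s) + (\<Sum>k\<in>{..<n} - {?s}. snd (node w k))" for w :: "(nat \<times> nat) list"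
      using s_less by (intro sum.remove) simp_all
    have rest: "(\<Sum>k\<in>{..<n} - {?s}. snd (node ?v' k)) = (\<Sum>k\<in>{..<n} - {?s}. snd (node ?v k))"
      by (intro sum.cong refl) (simp add: node)
    have "\<alpha> = 0 \<and> \<beta> = 1 \<or> \<alpha> = 1 \<and> \<beta> = 0" using ab by auto
    then have "(-1 :: complex) ^ (\<Sum>k<n. snd (node ?v' k)) = - ((-1) ^ (\<Sum>k<n. snd (node ?v k)))"
      unfolding sum_split rest by (auto simp: node_middle power_add)
    moreover have "map fst ?v' = map fst ?v" by simp
    ultimately show ?thesis
      unfolding fundamental_cycle_def compat by (simp only: power_add True if_True mult_minus_right)
  next
    case False
    then show ?thesis using compat by (simp add: fundamental_cycle_def)
  qed
qed

lemma sum_fundamental_cycle: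
  assumes u: "u \<in> falling {1..n}" "u \<in> labelled_perms n j" and w: "w \<in> labelled_perms n j" and s: "s \<in> {1..<n}"
  shows "(\<Sum>v\<in>neighbours n j s w. fundamental_cycle n u v) = 0"
proof -
  obtain i where i: "s = Suc i" using s by (cases s) auto
  have split: "\<exists>p x \<alpha> y \<beta> q. v = p @ (x, \<alpha>) # (y, \<beta>) # q \<and> length p = i \<and> x \<noteq> y"
    if v: "v \<in> labelled_perms n j" for v
  proof -
    have "length v = n" using v length_labelled[of v "{1..n}"] by (simp add: labelled_perms_def)
    then obtain p x \<alpha> y \<beta> q where pq: "v = p @ (x, \<alpha>) # (y, \<beta>) # q" "length p = i"
      using split_at[of i v] s i by auto
    moreover have "x \<noteq> y" using v unfolding pq(1) by (simp add: labelled_perms_def labelled_def)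
    ultimately show ?thesis by blast
  qed
  have exch: "p @ (x', \<alpha>') # (y', \<beta>') # q \<in> neighbours n j s w"
    if "p @ (x, \<alpha>) # (y, \<beta>) # q \<in> neighbours n j s w" "length p = i"
      "p @ (x', \<alpha>') # (y', \<beta>') # q \<in> labelled_perms n j" "{x', y'} = {x, y}" "\<alpha>' + \<beta>' = \<alpha> + \<beta>"
    for p x \<alpha> y \<beta> q x' \<alpha>' y' \<beta>'
    using that node_exchange[of x' y' x y \<alpha>' \<beta>' \<alpha> \<beta> _ p q] i by (simp add: neighbours_def)
  show ?thesis
  proof (cases "s \<in> ascents u")
    case False
    show ?thesis
    proof (rule sum_involution_eq_zero[where h = "swap_letters i"])
      fix v assume v: "v \<in> neighbours n j s w"
      then have vM: "v \<in> labelled_perms n j" by (simp add: neighbours_def)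
      then obtain p x \<alpha> y \<beta> q where pq: "v = p @ (x, \<alpha>) # (y, \<beta>) # q" "length p = i" "x \<noteq> y"
        using split by blast
      have h: "swap_letters i v = p @ (y, \<alpha>) # (x, \<beta>) # q"
        using swap_letters_append[of p] pq by simp
      have "p @ (y, \<alpha>) # (x, \<beta>) # q \<in> labelled_perms n j"
        using vM unfolding pq(1) by (cases p) (auto simp: labelled_perms_def labelled_def)
      then show "swap_letters i v \<in> neighbours n j s w"
        unfolding h using exch[of p x \<alpha> y \<beta> q y \<alpha> x \<beta>] v pq by auto
      show "swap_letters i (swap_letters i v) = v"
        unfolding h using swap_letters_append[of p y \<alpha> x \<beta> q] pq by simp
      show "fundamental_cycle n u (swap_letters i v) = - fundamental_cycle n u v"
        unfolding h unfolding pq(1) using False i pq(2,3) by (intro fundamental_cycle_swap_letters) simp_all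
    qed
  next
    case True
    have "2 \<le> s" using falling_labels_at_ascent(3)[OF u(1) True] .
    show ?thesis
    proof (rule sum_involution_eq_zero[where h = "swap_labels i"])
      fix v assume v: "v \<in> neighbours n j s w"
      then have vM: "v \<in> labelled_perms n j" by (simp add: neighbours_def)
      then obtain p x \<alpha> y \<beta> q where pq: "v = p @ (x, \<alpha>) # (y, \<beta>) # q" "length p = i"
        using split by blast
      \<comment> \<open>The exchange must not move a label 1 to the front of the word, where 0 is
        required; an ascent of a falling chain has rank at least 2.\<close>
      have "p \<noteq> []" using \<open>2 \<le> s\<close> i pq(2) by auto
      have h: "swap_labels i v = p @ (x, \<beta>) # (y, \<alpha>) # q"
        using swap_labels_append[of p] pq by simp
      have "p @ (x, \<beta>) # (y, \<alpha>) # q \<in> labelled_perms n j"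
        using vM \<open>p \<noteq> []\<close> unfolding pq(1) by (auto simp: labelled_perms_def labelled_def)
      then show "swap_labels i v \<in> neighbours n j s w"
        unfolding h using exch[of p x \<alpha> y \<beta> q x \<beta> y \<alpha>] v pq by auto
      show "swap_labels i (swap_labels i v) = v"
        unfolding h using swap_labels_append[of p x \<beta> y \<alpha> q] pq by simp
      show "fundamental_cycle n u (swap_labels i v) = - fundamental_cycle n u v"
        unfolding h unfolding pq(1) using fundamental_cycle_swap_labels[OF u, of p x \<alpha> y \<beta> q] True i pq vM by simp
    qed
  qed
qed

section \<open>Triangularity and the dimension count\<close>

lemma fundamental_cycle_self: "fundamental_cycle n u u \<noteq> 0"
  by (simp add: fundamental_cycle_def compatible_def)

text \<open>The sets shared at the ascents of u fix which letters fill each block between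
  consecutive ascents, and u lists every block in decreasing order, the lexicographically largest
  one.\<close>

lemma compatible_imp_letters_le:
  assumes u: "u \<in> labelled_perms n j" and v: "v \<in> labelled_perms n j" and compat: "compatible n u v"
  shows "map fst v \<le> map fst u"
proof (cases "map fst v = map fst u")
  case False
  define a where "a = map fst u"
  define b where "b = map fst v"
  have ul: "u \<in> labelled {1..n}" and vl: "v \<in> labelled {1..n}" using u v by (simp_all add: labelled_perms_def)
  have len: "length a = n" "length b = n"
    using length_labelled[OF ul] length_labelled[OF vl] by (simp_all add: a_def b_def)
  define i where "i = (LEAST i. i < n \<and> a ! i \<noteq> b ! i)"
  have "\<exists>i. i < n \<and> a ! i \<noteq> b ! i"
    using False len nth_equalityI[of b a] unfolding a_def[symmetric] b_def[symmetric] by metis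
  then have "i < n \<and> a ! i \<noteq> b ! i" unfolding i_def by (rule LeastI_ex)
  then have i: "i < n" "a ! i \<noteq> b ! i" by simp_all
  have same: "a ! k = b ! k" if "k < i" for k
    using not_less_Least[of k "\<lambda>i. i < n \<and> a ! i \<noteq> b ! i"] that i(1) by (auto simp: i_def[symmetric])
  \<comment> \<open>The end of the block of u that contains the first difference i: the next ascent,
    or n if none follows.\<close>
  define e where "e = (LEAST e. i < e \<and> (e \<in> ascents u \<or> e = n))"
  have "i < e \<and> (e \<in> ascents u \<or> e = n)"
    unfolding e_def by (rule LeastI[of _ n]) (use i in simp)
  then have e: "i < e" "e \<in> ascents u \<or> e = n" by simp_all
  have e_le: "e \<le> n" using e(2) len(1) by (auto simp: ascents_def a_def)
  have decreasing: "a ! k \<le> a ! i" if "i \<le> k" "k < e" for k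
    using that
  proof (induction k rule: dec_induct)
    case (step k)
    have "Suc k \<notin> ascents u"
      using not_less_Least[of "Suc k" "\<lambda>e. i < e \<and> (e \<in> ascents u \<or> e = n)"] step by (auto simp: e_def[symmetric])
    then have "a ! Suc k \<le> a ! k"
      using step.prems e_le len(1) by (simp add: ascents_def a_def not_less)
    then show ?case using step by simp
  qed simp
  have "fst (node v e) = fst (node u e)"
  proof (cases "e = n")
    case True
    then show ?thesis using node_labelled_perms_full[OF u] node_labelled_perms_full[OF v] by simp
  next
    case False
    then show ?thesis using compat e e_le by (simp add: compatible_def)
  qed
  then have "set (take e b) = set (take e a)" by (simp add: fst_node a_def b_def)
  moreover have "b ! i \<in> set (take e b)"
    using e(1) e_le len(2) by (auto simp: in_set_conv_nth intro!: exI[of _ i])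
  ultimately obtain k where k: "k < e" "b ! i = a ! k"
    using len e_le by (auto simp: in_set_conv_nth)
  \<comment> \<open>Before i the two words agree, so the letter \<open>b ! i\<close> cannot occur
    there without being repeated in b.\<close>
  have "i \<le> k"
  proof (rule ccontr)
    assume "\<not> i \<le> k"
    then have "k < i" by simp
    then have "b ! i = b ! k" using same k(2) by simp
    moreover have "distinct b" using vl by (simp add: b_def labelled_def)
    ultimately show False using \<open>k < i\<close> i(1) len(2) nth_eq_iff_index_eq[of b i k] by simp
  qed
  then have "b ! i < a ! i" using decreasing[of k] k i(2) by simp
  moreover have "take i b = take i a"
    using same i(1) len by (intro nth_take_lemma) simp_all
  moreover have "a = take i a @ a ! i # drop (Suc i) a" "b = take i b @ b ! i # drop (Suc i) b"
    using i(1) len by (simp_all add: id_take_nth_drop)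
  ultimately have "b < a" by (metis append_Cons_less)
  then show ?thesis by (simp add: a_def b_def)
qed simp

text \<open>If the letters agree, so do the ascents, and compatibility gives equal second
  coordinates off them. An ascent k is reached from k - 1, which is not an ascent, by a step with
  label 1 in both chains, so they agree everywhere.\<close>

lemma fundamental_cycle_triangular:
  assumes u: "u \<in> falling {1..n}" "label_sum u = j" and v: "v \<in> falling {1..n}" "label_sum v = j"
    and nz: "fundamental_cycle n u v \<noteq> 0"
  shows "v = u \<or> map fst v < map fst u"
proof (cases "map fst v = map fst u")
  case True
  have uM: "u \<in> labelled_perms n j" and vM: "v \<in> labelled_perms n j"
    using u v by (simp_all add: labelled_perms_def falling_def)
  have ul: "u \<in> labelled {1..n}" and vl: "v \<in> labelled {1..n}" using u v by (simp_all add: falling_def)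
  have len: "length u = n" "length v = n" using length_labelled[OF ul] length_labelled[OF vl] by simp_all
  have compat: "compatible n u v" using nz by (auto simp: fundamental_cycle_def split: if_splits)
  have "fst (v ! k) = fst (u ! k)" if "k < n" for k using True len that by (metis nth_map)
  then have asc: "ascents v = ascents u" using len by (auto simp: ascents_def)
  have snd: "snd (node v k) = snd (node u k)" if "k \<le> n" "k \<notin> ascents u" for k
  proof -
    consider "k = 0" | "k = n" | "k \<in> {1..<n}" using \<open>k \<le> n\<close> by force
    then show ?thesis
      using node_labelled_perms_full[OF uM] node_labelled_perms_full[OF vM] compat that(2)
      by cases (auto simp: compatible_def)
  qed
  have "node v k = node u k" if k: "k \<le> n" for k
  proof (rule prod_eqI)
    show "fst (node v k) = fst (node u k)" using True by (simp add: fst_node)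
    show "snd (node v k) = snd (node u k)"
    proof (cases "k \<in> ascents u")
      case asc_k: True
      note fu = falling_labels_at_ascent[OF u(1) asc_k]
      note fv = falling_labels_at_ascent[OF v(1) asc_k[folded asc]]
      have "snd (node v (k - 1)) = snd (node u (k - 1))" using snd[of "k - 1"] fu(4) k by simp
      moreover have "Suc (k - 1) = k" "k - 1 < n" using fu(3) k by simp_all
      ultimately show ?thesis
        using snd_node_Suc[of "k - 1" u] snd_node_Suc[of "k - 1" v] fu(1) fv(1) len by simp
    qed (use snd k in simp)
  qed
  then show ?thesis using labelled_eqI[OF vl ul] by simp
next
  case False
  have "compatible n u v" using nz by (auto simp: fundamental_cycle_def split: if_splits)
  then have "map fst v \<le> map fst u"
    using u v by (intro compatible_imp_letters_le[of u n j v]) (simp_all add: labelled_perms_def falling_def)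
  then show ?thesis using False order_le_imp_less_or_eq by blast
qed

lemma dim_reduced_homology_rees_ideal:
  assumes j: "j < n"
  shows "dim_reduced_homology (rees_ideal n j) (int n - 2) = eulerian n j"
proof -
  let ?r = "rees_ideal n j" and ?k = "int n - 2"
  define M where "M = labelled_perms n j"
  define D where "D = {u \<in> falling {1..n}. label_sum u = j}"
  have DM: "D \<subseteq> M" by (auto simp: D_def M_def falling_def labelled_perms_def)
  have finM: "finite M" by (simp add: M_def finite_labelled_perms)
  then have finD: "finite D" using DM finite_subset by blast
  have inj_M: "inj_on (maxchain n) M" unfolding M_def by (rule inj_on_maxchain)
  have supp: "order_simplices ?r ?k = maxchain n ` M" unfolding M_def by (rule order_simplices_rees_ideal[OF j])
  have "dim_reduced_homology ?r ?k = card (maxchain n ` D)"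
  proof (rule dim_reduced_homology_top)
    show "order_simplices ?r (?k + 1) = {}" by (rule no_bigger_simplices[OF j])
    show "finite (maxchain n ` D)" using finD by simp
  next
    fix f assume f: "f \<in> cycles ?r ?k" and zero: "\<And>c. c \<in> maxchain n ` D \<Longrightarrow> f c = 0"
    have fc: "f \<in> carrier (chain_space ?r ?k)" using f by (simp add: cycles_def)
    have "f (maxchain n u) = 0" if "u \<in> M" for u
    proof (rule cycle_eq_zero_of_zero_on_falling[where g = "\<lambda>u. f (maxchain n u)"])
      show "u \<in> labelled_perms n j" using that by (simp add: M_def)
    qed (use cycles_rees_ideal_iff[OF fc j] f zero in \<open>auto simp: D_def\<close>)
    moreover have "f c = 0" if "c \<notin> maxchain n ` M" for c
      using fc that by (auto simp: chain_space_def supp)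
    ultimately show "f = (\<lambda>c. 0)" unfolding fun_eq_iff by (metis imageE)
  next
    fix g :: "(nat set \<times> nat) set \<Rightarrow> complex"
    have "\<exists>c. \<forall>v\<in>D. (\<Sum>u\<in>D. c u * fundamental_cycle n u v) = g (maxchain n v)"
    proof (rule triangular_interpolation[OF finD, where key = "map fst"])
      show "fundamental_cycle n u u \<noteq> 0" for u by (rule fundamental_cycle_self)
      show "v = u \<or> map fst v < map fst u" if "u \<in> D" "v \<in> D" "fundamental_cycle n u v \<noteq> 0" for u v
        using that by (intro fundamental_cycle_triangular) (simp_all add: D_def)
    qed
    then obtain c where c: "\<And>v. v \<in> D \<Longrightarrow> (\<Sum>u\<in>D. c u * fundamental_cycle n u v) = g (maxchain n v)" by blast
    define h where "h v = (\<Sum>u\<in>D. c u * fundamental_cycle n u v)" for v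
    \<comment> \<open>The combination is carried from words to simplices; the value 0 elsewhere
      keeps its support within the simplices of top dimension.\<close>
    define f where "f t = (if t \<in> maxchain n ` M then h (the_inv_into M (maxchain n) t) else 0)" for t
    have f_h: "f (maxchain n v) = h v" if "v \<in> M" for v
      using that the_inv_into_f_f[OF inj_M] by (simp add: f_def)
    have "{t. f t \<noteq> 0} \<subseteq> maxchain n ` M" by (auto simp: f_def)
    moreover have "finite (maxchain n ` M)" using finM by simp
    ultimately have fc: "f \<in> carrier (chain_space ?r ?k)"
      using finite_subset by (auto simp: chain_space_def supp)
    have "(\<Sum>v\<in>neighbours n j s w. f (maxchain n v)) = 0" if w: "w \<in> labelled_perms n j" and s: "s \<in> {1..<n}" for w s
    proof -
      have "(\<Sum>v\<in>neighbours n j s w. f (maxchain n v)) = (\<Sum>v\<in>neighbours n j s w. h v)"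
        by (intro sum.cong refl f_h) (simp add: neighbours_def M_def)
      also have "\<dots> = (\<Sum>u\<in>D. c u * (\<Sum>v\<in>neighbours n j s w. fundamental_cycle n u v))"
        unfolding h_def by (subst sum.swap) (simp add: sum_distrib_left)
      also have "\<dots> = 0"
      proof (rule sum.neutral, rule ballI)
        fix u assume "u \<in> D"
        then have "u \<in> falling {1..n}" "u \<in> labelled_perms n j" using DM by (auto simp: D_def M_def)
        then show "c u * (\<Sum>v\<in>neighbours n j s w. fundamental_cycle n u v) = 0"
          using sum_fundamental_cycle w s by simp
      qed
      finally show ?thesis .
    qed
    then have "f \<in> cycles ?r ?k" using cycles_rees_ideal_iff[OF fc j] by blast
    moreover have "f t = g t" if "t \<in> maxchain n ` D" for t
      using that f_h c DM by (auto simp: h_def)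
    ultimately show "\<exists>f\<in>cycles ?r ?k. \<forall>t\<in>maxchain n ` D. f t = g t" by blast
  qed
  also have "\<dots> = card D" using inj_on_subset[OF inj_M DM] by (rule card_image)
  also have "\<dots> = eulerian n j" unfolding D_def by (rule card_falling)
  finally show ?thesis .
qed

theorem theorem1p2:
  fixes n :: nat
  assumes "n \<ge> 1"
  shows "\<forall>j \<in> {0..n - 1}.
           dim_reduced_homology (rees_ideal n j) (int n - 2) = eulerian n j \<and>
           eulerian n j = card {\<sigma>. \<sigma> permutes {1..n} \<and> card (excedances n \<sigma>) = j}"
  using assms dim_reduced_homology_rees_ideal eulerian_eq_card_excedances by auto

end
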